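(* Let $X_1,\dots,X_m$ be i.i.d. $U(0,1)$ random variables with empirical distribution $\widehat P_m$ and let $Y_1,\dots,Y_n$ be i.i.d. $U(0,1/2)$ random variables with empirical distribution $\widehat Q_n$, the two samples being independent, and suppose that $m,n\to\infty$ with $m/(m+n)\to\tau\in(0,1)$. Let $\mathcal{LS}_T$ denote the $\mathcal{LS}$-statistic with respect to the univariate Tukey depth. Then (a) $\displaystyle \sqrt{\frac{12\,m\,n}{m+n}}\left(\mathcal{LS}_T(\widehat P_m,\widehat Q_n)-\frac12\right)\xrightarrow{\mathcal D}N(0,5-4\tau)$, (b) $\displaystyle \sqrt{\frac{12\,m\,n}{m+n}}\left(\mathcal{LS}_T(\widehat Q_n,\widehat P_m)-\frac14\right)\xrightarrow{\mathcal D}N\left(0,\frac54-\tau\right)$. Both (a) and (b) remain true when $\mathcal{LS}_T$ is replaced by the original statistic $\widetilde{\mathcal{LS}}_T$ with respect to the Tukey depth.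
   Context: The univariate Tukey depth of $y\in\mathbb R$ with respect to a probability measure $\mu$ on $\mathbb R$ is $D_T(y,\mu)=\min(\mu((-\infty,y]),\mu([y,\infty)))$. The $\mathcal{LS}$-statistic with respect to $D_T$ is $$\mathcal{LS}_T(\widehat P_m,\widehat Q_n)=\frac1{mn}\sum_{i=1}^m\sum_{j=1}^n\left(\mathbb 1_{\{D_T(X_i,\widehat P_m)<D_T(Y_j,\widehat P_m)\}}+\tfrac12\mathbb 1_{\{D_T(X_i,\widehat P_m)=D_T(Y_j,\widehat P_m)\}}\right),$$ and the original (Liu–Singh) statistic is $$\widetilde{\mathcal{LS}}_T(\widehat P_m,\widehat Q_n)=\frac1{mn}\sum_{i=1}^m\sum_{j=1}^n\mathbb 1_{\{D_T(X_i,\widehat P_m)\le D_T(Y_j,\widehat P_m)\}}.$$ $\mathcal{LS}_T(\widehat Q_n,\widehat P_m)$ and $\widetilde{\mathcal{LS}}_T(\widehat Q_n,\widehat P_m)$ are obtained by exchanging the roles of the two samples, e.g. $\widetilde{\mathcal{LS}}_T(\widehat Q_n,\widehat P_m)=\frac1{mn}\sum_{i,j}\mathbb 1_{\{D_T(Y_j,\widehat Q_n)\le D_T(X_i,\widehat Q_n)\}}$. $\xrightarrow{\mathcal D}$ denotes convergence in distribution. *)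

theory Defs
  imports "HOL-Probability.Probability"
begin

(* The empirical distribution as the law of a uniformly drawn sample entry, so that
   repeated values are counted with multiplicity; meaningful only for N > 0. *)
definition empirical_measure :: "nat \<Rightarrow> (nat \<Rightarrow> real) \<Rightarrow> real measure" where
  "empirical_measure N x = distr (uniform_count_measure {..<N}) borel x"

definition tukey_depth :: "real \<Rightarrow> real measure \<Rightarrow> real" where
  "tukey_depth y \<mu> = min (measure \<mu> {..y}) (measure \<mu> {y..})"

(* The statistics depend on a depth function D. The first sample x (of size m) is the
   reference sample, whose empirical distribution determines all depths; exchanging the
   samples therefore means LS_stat D n y m x. *)
definition LS_stat ::
  "(real \<Rightarrow> real measure \<Rightarrow> real) \<Rightarrow> nat \<Rightarrow> (nat \<Rightarrow> real) \<Rightarrow> nat \<Rightarrow> (nat \<Rightarrow> real) \<Rightarrow> real" where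
  "LS_stat D m x n y =
     1 / (real m * real n) * (\<Sum>i<m. \<Sum>j<n.
        of_bool (D (x i) (empirical_measure m x) < D (y j) (empirical_measure m x)) +
        1 / 2 * of_bool (D (x i) (empirical_measure m x) = D (y j) (empirical_measure m x)))"

definition LS_stat_orig ::
  "(real \<Rightarrow> real measure \<Rightarrow> real) \<Rightarrow> nat \<Rightarrow> (nat \<Rightarrow> real) \<Rightarrow> nat \<Rightarrow> (nat \<Rightarrow> real) \<Rightarrow> real" where
  "LS_stat_orig D m x n y =
     1 / (real m * real n) * (\<Sum>i<m. \<Sum>j<n.
        of_bool (D (x i) (empirical_measure m x) \<le> D (y j) (empirical_measure m x)))"

(* The second parameter is the variance, whereas normal_density takes the standard deviation. *)
definition normal_distribution :: "real \<Rightarrow> real \<Rightarrow> real measure" where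
  "normal_distribution a v = density lborel (\<lambda>t. ennreal (normal_density a (sqrt v) t))"

(* Mutual independence within each sample, and independence of the two samples viewed as
   random vectors. *)
definition independent_samples ::
  "'a measure \<Rightarrow> nat \<Rightarrow> (nat \<Rightarrow> 'a \<Rightarrow> real) \<Rightarrow> nat \<Rightarrow> (nat \<Rightarrow> 'a \<Rightarrow> real) \<Rightarrow> bool" where
  "independent_samples M m X n Y \<longleftrightarrow>
     prob_space.indep_vars M (\<lambda>_. borel) X {..<m} \<and>
     prob_space.indep_vars M (\<lambda>_. borel) Y {..<n} \<and>
     prob_space.indep_var M
       (PiM {..<m} (\<lambda>_. borel)) (\<lambda>\<omega>. \<lambda>i\<in>{..<m}. X i \<omega>)
       (PiM {..<n} (\<lambda>_. borel)) (\<lambda>\<omega>. \<lambda>j\<in>{..<n}. Y j \<omega>)"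

lemma measure_empirical_measure:
  assumes "N > 0" and "A \<in> sets borel"
  shows "measure (empirical_measure N x) A = card {i. i < N \<and> x i \<in> A} / N"
proof -
  have "x \<in> uniform_count_measure {..<N} \<rightarrow>\<^sub>M borel"
    by (simp add: measurable_def sets_uniform_count_measure space_uniform_count_measure)
  then have "measure (empirical_measure N x) A =
      measure (uniform_count_measure {..<N}) (x -` A \<inter> {..<N})"
    using assms by (simp add: empirical_measure_def measure_distr space_uniform_count_measure)
  also have "\<dots> = card (x -` A \<inter> {..<N}) / N"
    using assms by (subst measure_uniform_count_measure) auto
  also have "x -` A \<inter> {..<N} = {i. i < N \<and> x i \<in> A}"
    by auto
  finally show ?thesis .
qed

end

theory Submission
  imports Defs
begin

text \<open>
  Without ties, the depth of the reference sample takes each value \<open>d / p\<close> with \<open>2 d \<le> p\<close> exactly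
  twice, so both statistics equal, up to \<open>1 / p\<close>, twice the mean of \<open>min (F\<^sub>p (V\<^sub>j)) (1 - F\<^sub>p (V\<^sub>j))\<close>
  over the test sample \<open>V\<close>, where \<open>F\<^sub>p\<close> is the empirical distribution function of the reference
  sample. The kink of the minimum sits at the median of the reference law, which the test law does
  not charge, and \<open>F\<^sub>p - F\<close> is of order \<open>1 / sqrt p\<close>; hence the branch of the minimum may be chosen by
  the true distribution function \<open>F\<close> at the cost of an error \<open>o(1 / sqrt p)\<close> in \<open>L\<^sup>1\<close>. What remains is a
  two-sample U-statistic. Its degenerate part is \<open>O(1 / sqrt (p q))\<close>, and its projection is a sum of
  two independent averages, whose characteristic functions converge by a Taylor expansion.
\<close>

subsection \<open>Second moments and characteristic functions\<close>

text \<open>The normalisation is of order sqrt p, so every discarded term must be o(1 / sqrt p) in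
  mean. For the branch error of the minimum the trivial bound is exactly of order 1 / sqrt p. The
  gain comes from the fact that a wrong branch forces F_p to cross 1/2: at a fixed v, second moments
  give order 1 / (p |1 - 2 F v|). This is not uniform near the median, and dominated convergence
  over the test law replaces a rate. Parts (a) and (b) concern the same pair of laws in opposite
  roles, so the argument treats a general reference law \<mu> and test law \<nu>. The probability
  space may change with k, so nothing is pathwise: the statistics are transported to product spaces,
  where mean absolute errors bound differences of characteristic functions. The constant 48 is 12,
  from the squared normalisation, times the square of the 2 in front of the mean depth. If the
  reference sample has limiting share \<rho>, the variance over the test sample gets weight \<rho>
  and that over the reference sample 1 - \<rho>; part (b) therefore uses \<rho> = 1 -
  \<tau>.\<close>

lemma (in prob_space) integral_abs_le_sqrt:
  fixes f :: "'a \<Rightarrow> real"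
  assumes [measurable]: "f \<in> borel_measurable M" and "integrable M (\<lambda>x. (f x)\<^sup>2)"
  shows "(\<integral>x. \<bar>f x\<bar> \<partial>M) \<le> sqrt (\<integral>x. (f x)\<^sup>2 \<partial>M)"
proof -
  have "integrable M f"
    using square_integrable_imp_integrable assms by blast
  then have "variance (\<lambda>x. \<bar>f x\<bar>) = (\<integral>x. (f x)\<^sup>2 \<partial>M) - (\<integral>x. \<bar>f x\<bar> \<partial>M)\<^sup>2"
    using assms by (subst variance_eq) auto
  moreover have "variance (\<lambda>x. \<bar>f x\<bar>) \<ge> 0"
    by (rule variance_positive)
  ultimately show ?thesis
    by (intro real_le_rsqrt) simp
qed

lemma sum_abs_le_card_mult:
  fixes f :: "'i \<Rightarrow> real"
  assumes "\<And>i. i \<in> A \<Longrightarrow> \<bar>f i\<bar> \<le> C"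
  shows "\<bar>\<Sum>i\<in>A. f i\<bar> \<le> real (card A) * C"
  by (rule order_trans[OF sum_abs]) (use assms sum_bounded_above[of A "\<lambda>i. \<bar>f i\<bar>" C] in simp)

lemma iid_sum_square:
  fixes g :: "'a \<Rightarrow> real"
  assumes "prob_space \<mu>" and g[measurable]: "g \<in> borel_measurable \<mu>"
    and bnd: "\<And>x. \<bar>g x\<bar> \<le> C" and mean: "(\<integral>x. g x \<partial>\<mu>) = 0"
  shows "(\<integral>x. (\<Sum>i<n. g (x i))\<^sup>2 \<partial>PiM {..<n} (\<lambda>_. \<mu>)) = real n * (\<integral>x. (g x)\<^sup>2 \<partial>\<mu>)"
proof -
  interpret \<mu>: prob_space \<mu> by fact
  interpret product_prob_space "\<lambda>_::nat. \<mu>" "{..<n}" ..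
  have fin: "finite_measure (PiM {..<n} (\<lambda>_. \<mu>))"
    by (rule prob_space.finite_measure) (rule prob_space_axioms)
  have "C \<ge> 0"
    using bnd[of undefined] by linarith
  have int_g: "integrable \<mu> g"
    by (rule \<mu>.integrable_const_bound[of _ C]) (auto simp: bnd)
  have gg: "\<bar>g x * g y\<bar> \<le> C * C" for x y
    unfolding abs_mult by (intro mult_mono bnd abs_ge_zero \<open>C \<ge> 0\<close>)
  have int_g2: "integrable \<mu> (\<lambda>x. g x * g x)"
    by (rule \<mu>.integrable_const_bound[of _ "C * C"])
       (simp_all only: real_norm_def gg AE_I2, measurable)
  have int_ij: "integrable (PiM {..<n} (\<lambda>_. \<mu>)) (\<lambda>x. g (x i) * g (x j))"
    if [simp]: "i < n" "j < n" for i j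
    by (rule finite_measure.integrable_const_bound[OF fin, of _ "C * C"])
       (simp_all only: real_norm_def gg AE_I2, measurable)
  have ij: "(\<integral>x. g (x i) * g (x j) \<partial>PiM {..<n} (\<lambda>_. \<mu>)) = (if i = j then \<integral>x. (g x)\<^sup>2 \<partial>\<mu> else 0)"
    if [simp]: "i < n" "j < n" for i j
  proof -
    \<comment> \<open>Makes \<open>g (x i) * g (x j)\<close> a product over all coordinates with
      factor 1 elsewhere. For \<open>i = j\<close> both conditions hit the same factor, so one
      product formula serves diagonal and off-diagonal terms.\<close>
    define f where "f l = (\<lambda>u. (if l = i then g u else 1) * (if l = j then g u else 1))" for l :: nat
    have "(\<Prod>l<n. f l (x l)) = g (x i) * g (x j)" for x
      by (simp add: f_def prod.distrib prod.delta)
    moreover have "(\<integral>x. (\<Prod>l<n. f l (x l)) \<partial>PiM {..<n} (\<lambda>_. \<mu>)) = (\<Prod>l<n. \<integral>u. f l u \<partial>\<mu>)"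
    proof (rule product_integral_prod)
      show "integrable \<mu> (f l)" for l
        by (cases "l = i"; cases "l = j") (simp_all add: f_def int_g int_g2)
    qed auto
    moreover have "(\<Prod>l<n. \<integral>u. f l u \<partial>\<mu>) = (if i = j then \<integral>x. (g x)\<^sup>2 \<partial>\<mu> else 0)"
    proof (cases "i = j")
      case True
      then have "(\<integral>u. f l u \<partial>\<mu>) = (if l = i then \<integral>x. (g x)\<^sup>2 \<partial>\<mu> else 1)" for l
        by (simp add: f_def power2_eq_square \<mu>.prob_space)
      then show ?thesis using True by (simp add: prod.delta)
    next
      case False
      then have "(\<integral>u. f i u \<partial>\<mu>) = 0"
        by (simp add: f_def mean)
      then show ?thesis using False
        by (simp add: prod_zero_iff) (use that in blast)
    qed
    ultimately show ?thesis by simp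
  qed
  have "(\<integral>x. (\<Sum>i<n. g (x i))\<^sup>2 \<partial>PiM {..<n} (\<lambda>_. \<mu>))
      = (\<integral>x. (\<Sum>i<n. \<Sum>j<n. g (x i) * g (x j)) \<partial>PiM {..<n} (\<lambda>_. \<mu>))"
    by (simp add: power2_eq_square sum_product)
  also have "\<dots> = (\<Sum>i<n. \<Sum>j<n. \<integral>x. g (x i) * g (x j) \<partial>PiM {..<n} (\<lambda>_. \<mu>))"
    by (subst Bochner_Integration.integral_sum)
       (auto intro!: Bochner_Integration.integrable_sum sum.cong Bochner_Integration.integral_sum int_ij)
  also have "\<dots> = (\<Sum>i<n. \<Sum>j<n. if i = j then \<integral>x. (g x)\<^sup>2 \<partial>\<mu> else 0)"
    by (intro sum.cong refl ij) auto
  also have "\<dots> = real n * (\<integral>x. (g x)\<^sup>2 \<partial>\<mu>)"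
    by simp
  finally show ?thesis .
qed

lemma iid_sum_square_le:
  fixes g :: "'a \<Rightarrow> real"
  assumes "prob_space \<mu>" and g[measurable]: "g \<in> borel_measurable \<mu>"
    and bnd: "\<And>x. \<bar>g x\<bar> \<le> C" and mean: "(\<integral>x. g x \<partial>\<mu>) = 0"
  shows "(\<integral>x. (\<Sum>i<n. g (x i))\<^sup>2 \<partial>PiM {..<n} (\<lambda>_. \<mu>)) \<le> real n * C\<^sup>2"
proof -
  interpret prob_space \<mu> by fact
  have "(g x)\<^sup>2 \<le> C\<^sup>2" for x
    using bnd[of x] by (metis abs_ge_zero power2_abs power_mono)
  then have "(\<integral>x. (g x)\<^sup>2 \<partial>\<mu>) \<le> C\<^sup>2"
    by (intro integral_le_const integrable_const_bound[of _ "C\<^sup>2"]) auto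
  then show ?thesis
    by (simp add: iid_sum_square[OF assms] mult_left_mono)
qed

text \<open>
  For a fixed second sample the double sum is an i.i.d. centred sum in the first sample, and after
  taking its second moment the summands are i.i.d. centred sums in the second sample.
\<close>

lemma degenerate_kernel_sum_le:
  fixes h :: "'a \<Rightarrow> 'b \<Rightarrow> real"
  assumes "prob_space \<mu>" "prob_space \<nu>"
    and h[measurable]: "case_prod h \<in> borel_measurable (\<mu> \<Otimes>\<^sub>M \<nu>)"
    and bnd: "\<And>u v. \<bar>h u v\<bar> \<le> C"
    and mean_u: "\<And>v. v \<in> space \<nu> \<Longrightarrow> (\<integral>u. h u v \<partial>\<mu>) = 0"
    and mean_v: "\<And>u. u \<in> space \<mu> \<Longrightarrow> (\<integral>v. h u v \<partial>\<nu>) = 0"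
  shows "(\<integral>z. \<bar>\<Sum>i<p. \<Sum>j<q. h (fst z i) (snd z j)\<bar> \<partial>(PiM {..<p} (\<lambda>_. \<mu>) \<Otimes>\<^sub>M PiM {..<q} (\<lambda>_. \<nu>)))
    \<le> C * sqrt (real p * real q)"
proof -
  interpret \<mu>: prob_space \<mu> by fact
  interpret \<nu>: prob_space \<nu> by fact
  interpret P: product_prob_space "\<lambda>_::nat. \<mu>" "{..<p}" ..
  interpret Q: product_prob_space "\<lambda>_::nat. \<nu>" "{..<q}" ..
  let ?P = "PiM {..<p} (\<lambda>_. \<mu>)" and ?Q = "PiM {..<q} (\<lambda>_. \<nu>)"
  interpret PQ: pair_prob_space ?P ?Q ..
  interpret mQ: pair_prob_space \<mu> ?Q ..
  have "C \<ge> 0"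
    using bnd[of undefined undefined] by linarith
  let ?S = "\<lambda>x y. \<Sum>i<p. \<Sum>j<q. h (x i) (y j)"
  have S_meas[measurable]: "(\<lambda>z. ?S (fst z) (snd z)) \<in> borel_measurable (?P \<Otimes>\<^sub>M ?Q)"
    by measurable
  have S_bnd: "\<bar>?S x y\<bar> \<le> real p * (real q * C)" for x y
    using sum_abs_le_card_mult[of "{..<p}" "\<lambda>i. \<Sum>j<q. h (x i) (y j)" "real q * C"]
      sum_abs_le_card_mult[of "{..<q}" "\<lambda>j. h (x i) (y j)" C for i] bnd
    by simp
  have H_bnd: "\<bar>\<Sum>j<q. h u (y j)\<bar> \<le> real q * C" for u y
    using sum_abs_le_card_mult[of "{..<q}" "\<lambda>j. h u (y j)" C] bnd by simp
  have int_S2: "integrable (?P \<Otimes>\<^sub>M ?Q) (\<lambda>z. (?S (fst z) (snd z))\<^sup>2)"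
    by (rule PQ.integrable_const_bound[of _ "(real p * (real q * C))\<^sup>2"])
       (auto intro!: abs_le_square_iff[THEN iffD1] order_trans[OF S_bnd] simp: \<open>C \<ge> 0\<close>)
  have int_H2: "integrable (\<mu> \<Otimes>\<^sub>M ?Q) (\<lambda>z. (\<Sum>j<q. h (fst z) (snd z j))\<^sup>2)"
    by (rule mQ.integrable_const_bound[of _ "(real q * C)\<^sup>2"])
       (auto intro!: abs_le_square_iff[THEN iffD1] order_trans[OF H_bnd] simp: \<open>C \<ge> 0\<close>)
  have inner: "(\<integral>x. (?S x y)\<^sup>2 \<partial>?P) = real p * (\<integral>u. (\<Sum>j<q. h u (y j))\<^sup>2 \<partial>\<mu>)"
    if y[measurable]: "y \<in> space ?Q" for y
  proof (rule iid_sum_square[where C = "real q * C"])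
    have yj[measurable]: "y j \<in> space \<nu>" if "j < q" for j
      using y that by (auto simp: space_PiM)
    have hm: "(\<lambda>u. h u (y j)) \<in> borel_measurable \<mu>" if "j < q" for j
      using measurable_compose[OF measurable_Pair2'[OF yj[OF that]] h] by simp
    then show "(\<lambda>u. \<Sum>j<q. h u (y j)) \<in> borel_measurable \<mu>"
      by (intro borel_measurable_sum) auto
    have "integrable \<mu> (\<lambda>u. h u (y j))" if "j < q" for j
      using hm[OF that] by (intro \<mu>.integrable_const_bound[of _ C]) (auto simp: bnd)
    then show "(\<integral>u. (\<Sum>j<q. h u (y j)) \<partial>\<mu>) = 0"
      by (subst Bochner_Integration.integral_sum) (auto simp: mean_u yj)
  qed (auto simp: H_bnd \<mu>.prob_space_axioms)
  have inner2: "(\<integral>y. (\<Sum>j<q. h u (y j))\<^sup>2 \<partial>?Q) \<le> real q * C\<^sup>2" if u: "u \<in> space \<mu>" for u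
    using measurable_compose[OF measurable_Pair1'[OF u] h]
    by (intro iid_sum_square_le) (auto simp: bnd mean_v u \<nu>.prob_space_axioms)
  have "(\<integral>z. (?S (fst z) (snd z))\<^sup>2 \<partial>(?P \<Otimes>\<^sub>M ?Q)) = (\<integral>y. (\<integral>x. (?S x y)\<^sup>2 \<partial>?P) \<partial>?Q)"
    using PQ.integral_snd[of "\<lambda>x y. (?S x y)\<^sup>2"] int_S2 by (simp add: case_prod_beta')
  also have "\<dots> = (\<integral>y. real p * (\<integral>u. (\<Sum>j<q. h u (y j))\<^sup>2 \<partial>\<mu>) \<partial>?Q)"
    by (intro Bochner_Integration.integral_cong refl inner)
  also have "\<dots> = real p * (\<integral>u. (\<integral>y. (\<Sum>j<q. h u (y j))\<^sup>2 \<partial>?Q) \<partial>\<mu>)"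
    using mQ.Fubini_integral[of "\<lambda>u y. (\<Sum>j<q. h u (y j))\<^sup>2"] int_H2 by (simp add: case_prod_beta')
  also have "\<dots> \<le> real p * (real q * C\<^sup>2)"
    using mQ.integrable_fst'[OF int_H2]
    by (intro mult_left_mono \<mu>.integral_le_const) (auto simp: inner2)
  finally have "(\<integral>z. (?S (fst z) (snd z))\<^sup>2 \<partial>(?P \<Otimes>\<^sub>M ?Q)) \<le> real p * (real q * C\<^sup>2)" .
  then have "sqrt (\<integral>z. (?S (fst z) (snd z))\<^sup>2 \<partial>(?P \<Otimes>\<^sub>M ?Q)) \<le> sqrt (real p * (real q * C\<^sup>2))"
    by (rule real_sqrt_le_mono)
  also have "\<dots> = C * sqrt (real p * real q)"
    using \<open>C \<ge> 0\<close> by (simp add: real_sqrt_mult)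
  finally show ?thesis
    using PQ.integral_abs_le_sqrt[OF S_meas int_S2] by linarith
qed

section \<open>Normal law and characteristic functions at small frequencies\<close>

lemma char_normal_distribution:
  assumes "v > 0"
  shows "char (normal_distribution 0 v) t = complex_of_real (exp (- (v * t\<^sup>2) / 2))"
    and "real_distribution (normal_distribution 0 v)"
proof -
  interpret N: real_distribution std_normal_distribution
    by (rule real_dist_normal_dist)
  have "distributed std_normal_distribution lborel (\<lambda>x. x) (normal_density 0 1)"
    by (simp add: distributed_def distr_id2)
  then have "distributed std_normal_distribution lborel (\<lambda>x. 0 + sqrt v * x)
      (normal_density (0 + sqrt v * 0) (\<bar>sqrt v\<bar> * 1))"
    using assms by (intro N.normal_density_affine) auto
  then have "normal_distribution 0 v = distr std_normal_distribution lborel (\<lambda>x. sqrt v * x)"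
    using assms by (simp add: distributed_def normal_distribution_def)
  also have "\<dots> = distr std_normal_distribution borel (\<lambda>x. sqrt v * x)"
    by (intro distr_cong) auto
  finally have eq: "normal_distribution 0 v = distr std_normal_distribution borel (\<lambda>x. sqrt v * x)" .
  show "real_distribution (normal_distribution 0 v)"
    unfolding eq by (intro N.real_distribution_distr) auto
  have "char (normal_distribution 0 v) t = char std_normal_distribution (t * sqrt v)"
    unfolding eq char_def by (subst integral_distr) (auto simp: mult_ac)
  then show "char (normal_distribution 0 v) t = complex_of_real (exp (- (v * t\<^sup>2) / 2))"
    using assms by (simp add: char_std_normal_distribution power_mult_distrib mult_ac)
qed

text \<open>The map from \<open>a\<close> to \<open>iexp (t * a)\<close> is Lipschitz with constant
  \<open>\<bar>t\<bar>\<close>. At a fixed frequency an error that vanishes in mean absolute value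
  therefore leaves the limit unchanged, which takes the place of a Slutsky argument.\<close>

lemma (in prob_space) cmod_integral_iexp_diff_le:
  assumes [measurable]: "f \<in> borel_measurable M" "g \<in> borel_measurable M"
    and "integrable M (\<lambda>x. \<bar>f x - g x\<bar>)"
  shows "cmod ((CLINT x|M. iexp (t * f x)) - (CLINT x|M. iexp (t * g x)))
    \<le> \<bar>t\<bar> * (\<integral>x. \<bar>f x - g x\<bar> \<partial>M)"
proof -
  have pt: "cmod (iexp (t * a) - iexp (t * b)) \<le> \<bar>t\<bar> * \<bar>a - b\<bar>" for a b
  proof -
    have "iexp (t * a) - iexp (t * b) = iexp (t * b) * (iexp (t * (a - b)) - 1)"
      by (simp add: algebra_simps flip: exp_add)
    then show ?thesis
      using iexp_approx1[of "t * (a - b)" 0] by (simp add: norm_mult abs_mult)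
  qed
  have [simp]: "integrable M (\<lambda>x. exp (\<i> * (complex_of_real t * complex_of_real (f x))))"
    if [measurable]: "f \<in> borel_measurable M" for f
    by (rule integrable_iexp) auto
  have "cmod ((CLINT x|M. iexp (t * f x)) - (CLINT x|M. iexp (t * g x)))
      = cmod (CLINT x|M. iexp (t * f x) - iexp (t * g x))"
    by (subst Bochner_Integration.integral_diff) auto
  also have "\<dots> \<le> (\<integral>x. cmod (iexp (t * f x) - iexp (t * g x)) \<partial>M)"
    by (rule integral_norm_bound)
  also have "\<dots> \<le> (\<integral>x. \<bar>t\<bar> * \<bar>f x - g x\<bar> \<partial>M)"
    using assms by (intro integral_mono pt) auto
  finally show ?thesis by simp
qed

text \<open>Second-order Taylor expansion, followed by replacing \<open>1 - s\<close> with
  \<open>exp (- s)\<close>. The constants are crude; what matters is that both errors are of higher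
  order than \<open>t\<^sup>2\<close> as \<open>t\<close> tends to 0.\<close>

lemma (in prob_space) char_bounded_approx:
  fixes f :: "'a \<Rightarrow> real"
  assumes [measurable]: "f \<in> borel_measurable M" and bnd: "\<And>x. \<bar>f x\<bar> \<le> C"
    and mean: "expectation f = 0" and var: "expectation (\<lambda>x. (f x)\<^sup>2) = v"
  shows "cmod ((CLINT x|M. iexp (t * f x)) - exp (- (v * t\<^sup>2) / 2)) \<le> C ^ 3 * \<bar>t\<bar> ^ 3 + v\<^sup>2 * t ^ 4"
proof -
  have "C \<ge> 0" using bnd[of undefined] by linarith
  have b2: "(f x)\<^sup>2 \<le> C\<^sup>2" for x
    using bnd[of x] by (metis abs_ge_zero power2_abs power_mono)
  have int: "integrable M f" "integrable M (\<lambda>x. (f x)\<^sup>2)"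
    using bnd b2 by (auto intro: integrable_const_bound[of _ C] integrable_const_bound[of _ "C\<^sup>2"])
  have int_min: "integrable M (\<lambda>x. min (6 * (f x)\<^sup>2) (\<bar>t\<bar> * \<bar>f x\<bar> ^ 3))"
    by (rule Bochner_Integration.integrable_bound[of M "\<lambda>x. 6 * (f x)\<^sup>2"]) (auto simp: int)
  have v: "v \<ge> 0" unfolding var[symmetric] by simp
  have "cmod (char (distr M borel f) t - (1 - t\<^sup>2 * v / 2))
      \<le> (t\<^sup>2 / 6) * expectation (\<lambda>x. min (6 * (f x)\<^sup>2) (\<bar>t\<bar> * \<bar>f x\<bar> ^ 3))"
    using int mean var by (intro char_approx3') auto
  also have "\<dots> \<le> (t\<^sup>2 / 6) * (\<bar>t\<bar> * C ^ 3)"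
    using int_min bnd
    by (intro mult_left_mono integral_le_const) (auto intro!: min.coboundedI2 mult_left_mono power_mono)
  also have "\<dots> \<le> C ^ 3 * \<bar>t\<bar> ^ 3"
  proof -
    have "(t\<^sup>2 / 6) * (\<bar>t\<bar> * C ^ 3) = C ^ 3 * \<bar>t\<bar> ^ 3 / 6"
      by (simp add: power3_eq_cube power2_eq_square)
    also have "\<dots> \<le> C ^ 3 * \<bar>t\<bar> ^ 3"
      using \<open>C \<ge> 0\<close> by simp
    finally show ?thesis .
  qed
  finally have 1: "cmod ((CLINT x|M. iexp (t * f x)) - (1 - t\<^sup>2 * v / 2)) \<le> C ^ 3 * \<bar>t\<bar> ^ 3"
    by (simp add: char_def integral_distr)
  define s where "s = t\<^sup>2 * v / 2"
  have s: "s \<ge> 0" using v by (simp add: s_def)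
  have "exp (- s) \<ge> 1 - s" using exp_ge_add_one_self[of "-s"] by simp
  moreover have "exp (- s) \<le> 1 - s + s\<^sup>2"
  proof -
    have "exp (-s) \<le> 1 / (1 + s)"
      using exp_ge_add_one_self[of s] s by (simp add: exp_minus field_simps)
    \<comment> \<open>Rests on \<open>(1 + s) * (1 - s + s\<^sup>2) = 1 + s ^ 3\<close>.\<close>
    also have "\<dots> \<le> 1 - s + s\<^sup>2"
      using s by (simp add: field_simps power2_eq_square)
    finally show ?thesis .
  qed
  ultimately have "\<bar>(1 - s) - exp (- s)\<bar> \<le> s\<^sup>2" by simp
  then have "cmod ((1 - t\<^sup>2 * v / 2) - exp (- (v * t\<^sup>2) / 2)) \<le> s\<^sup>2"
    unfolding s_def
    by (metis (no_types, lifting) minus_divide_left mult.commute norm_of_real of_real_diff)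
  also have "s\<^sup>2 \<le> v\<^sup>2 * t ^ 4"
    by (simp add: s_def power_mult_distrib power_divide mult.commute[of "v\<^sup>2"] flip: power_mult)
  finally have 2: "cmod ((1 - t\<^sup>2 * v / 2) - exp (- (v * t\<^sup>2) / 2)) \<le> v\<^sup>2 * t ^ 4" .
  show ?thesis
    using norm_triangle_ineq[of "(CLINT x|M. iexp (t * f x)) - (1 - t\<^sup>2 * v / 2)"
        "(1 - t\<^sup>2 * v / 2) - exp (- (v * t\<^sup>2) / 2)"] 1 2 by simp
qed

text \<open>In the closed unit disc, n-th powers differ by at most n times the difference of the
  bases. Since \<open>n k * (s k)\<^sup>2\<close> converges, the errors of order three and four in
  \<open>s k\<close> survive this factor and still vanish. The exponent and the frequency are
  separate sequences because the frequency seen by one sample also depends on the size of the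
  other.\<close>

lemma (in prob_space) char_power_tendsto:
  fixes f :: "'a \<Rightarrow> real" and n :: "nat \<Rightarrow> nat"
  assumes [measurable]: "f \<in> borel_measurable M" and bnd: "\<And>x. \<bar>f x\<bar> \<le> C"
    and mean: "expectation f = 0" and var: "expectation (\<lambda>x. (f x)\<^sup>2) = v"
    and s: "s \<longlonglongrightarrow> 0" and L: "(\<lambda>k. real (n k) * (s k)\<^sup>2) \<longlonglongrightarrow> L"
  shows "(\<lambda>k. (CLINT x|M. iexp (s k * f x)) ^ n k) \<longlonglongrightarrow> exp (- (v * L) / 2)"
proof -
  define e where "e k = complex_of_real (exp (- (v * (s k)\<^sup>2) / 2))" for k
  have v: "v \<ge> 0" unfolding var[symmetric] by simp
  have "cmod ((CLINT x|M. iexp (s k * f x)) ^ n k - e k ^ n k)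
      \<le> real (n k) * (s k)\<^sup>2 * (C ^ 3 * \<bar>s k\<bar> + v\<^sup>2 * (s k)\<^sup>2)" for k
  proof -
    interpret D: real_distribution "distr M borel f"
      by (rule real_distribution_distr) simp
    have "(CLINT x|M. iexp (s k * f x)) = char (distr M borel f) (s k)"
      by (simp add: char_def integral_distr)
    then have "cmod (CLINT x|M. iexp (s k * f x)) \<le> 1"
      using D.cmod_char_le_1 by simp
    moreover have "cmod (e k) \<le> 1"
      using v unfolding e_def norm_of_real by simp
    ultimately have "cmod ((CLINT x|M. iexp (s k * f x)) ^ n k - e k ^ n k)
        \<le> real (n k) * cmod ((CLINT x|M. iexp (s k * f x)) - e k)"
      by (rule norm_power_diff)
    also have "\<dots> \<le> real (n k) * (C ^ 3 * \<bar>s k\<bar> ^ 3 + v\<^sup>2 * (s k) ^ 4)"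
      using char_bounded_approx[OF _ bnd mean var, of "s k"] by (intro mult_left_mono) (auto simp: e_def)
    also have "\<dots> = real (n k) * (s k)\<^sup>2 * (C ^ 3 * \<bar>s k\<bar> + v\<^sup>2 * (s k)\<^sup>2)"
    proof -
      have "\<bar>s k\<bar> ^ 3 = (s k)\<^sup>2 * \<bar>s k\<bar>" "s k ^ 4 = (s k)\<^sup>2 * (s k)\<^sup>2"
        by (simp_all add: power2_eq_square power3_eq_cube power4_eq_xxxx)
      then show ?thesis by (simp add: algebra_simps)
    qed
    finally show ?thesis .
  qed
  moreover have "(\<lambda>k. real (n k) * (s k)\<^sup>2 * (C ^ 3 * \<bar>s k\<bar> + v\<^sup>2 * (s k)\<^sup>2)) \<longlonglongrightarrow> L * (C ^ 3 * \<bar>0\<bar> + v\<^sup>2 * 0\<^sup>2)"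
    by (intro tendsto_intros s L)
  then have "(\<lambda>k. real (n k) * (s k)\<^sup>2 * (C ^ 3 * \<bar>s k\<bar> + v\<^sup>2 * (s k)\<^sup>2)) \<longlonglongrightarrow> 0"
    by simp
  ultimately have 1: "(\<lambda>k. (CLINT x|M. iexp (s k * f x)) ^ n k - e k ^ n k) \<longlonglongrightarrow> 0"
    by (rule Lim_null_comparison[OF always_eventually[OF allI]])
  have "e k ^ n k = complex_of_real (exp (- (v * (real (n k) * (s k)\<^sup>2)) / 2))" for k
  proof -
    have "real (n k) * (- (v * (s k)\<^sup>2) / 2) = - (v * (real (n k) * (s k)\<^sup>2)) / 2"
      by simp
    then have "exp (- (v * (s k)\<^sup>2) / 2) ^ n k = exp (- (v * (real (n k) * (s k)\<^sup>2)) / 2)"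
      by (metis exp_of_nat_mult)
    then show ?thesis
      unfolding e_def by (metis of_real_power)
  qed
  moreover have "(\<lambda>k. complex_of_real (exp (- (v * (real (n k) * (s k)\<^sup>2)) / 2)))
      \<longlonglongrightarrow> complex_of_real (exp (- (v * L) / 2))"
    by (intro tendsto_intros L) auto
  ultimately show ?thesis
    using Lim_transform[OF _ 1] by simp
qed

subsection \<open>Tukey depth with respect to an empirical distribution\<close>

lemma tukey_depth_empirical_measure:
  assumes "p > 0"
  shows "tukey_depth v (empirical_measure p x) =
    min (real (card {i. i < p \<and> x i \<le> v})) (real (card {i. i < p \<and> v \<le> x i})) / real p"
  using assms by (simp add: tukey_depth_def measure_empirical_measure min_divide_distrib_right)

text \<open>\<open>min r (p + 1 - r)\<close> is \<open>p\<close> times the depth of the reference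
  point of rank \<open>r\<close>: its two closed half-lines hold \<open>r\<close> and
  \<open>p + 1 - r\<close> points, itself included in both. The points of small depth are the
  \<open>d\<close> lowest and the \<open>d\<close> highest, and \<open>2 * d \<le> p\<close> keeps
  these groups apart.\<close>

lemma card_le_min_rank:
  fixes p d :: nat
  assumes "2 * d \<le> p"
  shows "card {r \<in> {1..p}. min r (p + 1 - r) \<le> d} = 2 * d"
proof -
  have "{r \<in> {1..p}. min r (p + 1 - r) \<le> d} = {1..d} \<union> {p + 1 - d..p}"
    using assms by (auto simp: min_def)
  moreover have "{1..d} \<inter> {p + 1 - d..p} = {}"
    using assms by auto
  ultimately show ?thesis
    using assms by (simp add: card_Un_disjoint)
qed

text \<open>Bounds the reference points that tie in depth with a given test point; each such tie
  costs half a count in \<open>LS_stat\<close>.\<close>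

lemma card_eq_min_rank:
  fixes p d :: nat
  shows "card {r \<in> {1..p}. min r (p + 1 - r) = d} \<le> 2"
proof -
  have "{r \<in> {1..p}. min r (p + 1 - r) = d} \<subseteq> {d, p + 1 - d}"
    by (auto simp: min_def split: if_splits)
  then have "card {r \<in> {1..p}. min r (p + 1 - r) = d} \<le> card {d, p + 1 - d}"
    by (intro card_mono) auto
  also have "\<dots> \<le> 2" by (simp add: card_insert_if)
  finally show ?thesis .
qed

lemma card_ge_eq_diff:
  fixes x :: "nat \<Rightarrow> real"
  shows "card {l. l < p \<and> v \<le> x l} = p - card {l. l < p \<and> x l < v}"
proof -
  have "{l. l < p \<and> v \<le> x l} = {..<p} - {l. l < p \<and> x l < v}" by auto
  then show ?thesis by (simp add: card_Diff_subset subset_eq)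
qed

text \<open>A larger value has a strictly larger rank, so the ranks are \<open>p\<close> distinct
  elements of \<open>{1..p}\<close> and exhaust it. The \<open>+ 1\<close> in the second claim
  arises because entry \<open>i\<close> lies in both of its half-lines.\<close>

lemma
  fixes x :: "nat \<Rightarrow> real"
  assumes inj: "inj_on x {..<p}"
  defines "r \<equiv> \<lambda>i. card {l. l < p \<and> x l \<le> x i}"
  shows bij_betw_rank: "bij_betw r {..<p} {1..p}"
    and card_ge_rank: "i < p \<Longrightarrow> card {l. l < p \<and> x i \<le> x l} = p + 1 - r i"
proof -
  have less: "r i < r j" if "x i < x j" "j < p" for i j
  proof -
    have "{l. l < p \<and> x l \<le> x i} \<subseteq> {l. l < p \<and> x l \<le> x j}"
      using that by auto
    moreover have "j \<in> {l. l < p \<and> x l \<le> x j}" "j \<notin> {l. l < p \<and> x l \<le> x i}"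
      using that by auto
    ultimately have "{l. l < p \<and> x l \<le> x i} \<subset> {l. l < p \<and> x l \<le> x j}"
      by (metis psubsetI)
    then show ?thesis
      unfolding r_def by (rule psubset_card_mono[rotated]) simp
  qed
  have inj_r: "inj_on r {..<p}"
  proof (rule inj_onI)
    fix i j assume "i \<in> {..<p}" "j \<in> {..<p}" "r i = r j"
    with less[of i j] less[of j i] have "x i = x j" by force
    with inj \<open>i \<in> _\<close> \<open>j \<in> _\<close> show "i = j" by (auto dest: inj_onD)
  qed
  have "r ` {..<p} \<subseteq> {1..p}"
  proof safe
    fix i assume "i < p"
    then have "{i} \<subseteq> {l. l < p \<and> x l \<le> x i}" by auto
    from card_mono[OF _ this] have "1 \<le> r i" by (simp add: r_def)
    moreover have "r i \<le> card {..<p}"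
      unfolding r_def by (intro card_mono) auto
    ultimately show "r i \<in> {1..p}" by simp
  qed
  then have "r ` {..<p} = {1..p}"
    using inj_r by (intro card_subset_eq) (auto simp: card_image)
  with inj_r show "bij_betw r {..<p} {1..p}" by (simp add: bij_betw_def)
  show "card {l. l < p \<and> x i \<le> x l} = p + 1 - r i" if "i < p"
  proof -
    have "{l. l < p \<and> x l \<le> x i} = insert i {l. l < p \<and> x l < x i}"
      using that by (auto simp: order_less_le dest: inj_onD[OF inj])
    then have "r i = Suc (card {l. l < p \<and> x l < x i})"
      unfolding r_def by simp
    then show ?thesis by (simp add: card_ge_eq_diff)
  qed
qed

section \<open>Reduction of both statistics to the mean empirical depth\<close>

definition empirical_cdf :: "nat \<Rightarrow> (nat \<Rightarrow> real) \<Rightarrow> real \<Rightarrow> real" where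
  "empirical_cdf p x v = real (card {i. i < p \<and> x i \<le> v}) / real p"

definition mean_empirical_depth :: "nat \<Rightarrow> (nat \<Rightarrow> real) \<Rightarrow> nat \<Rightarrow> (nat \<Rightarrow> real) \<Rightarrow> real" where
  "mean_empirical_depth p x q y =
     (\<Sum>j<q. min (empirical_cdf p x (y j)) (1 - empirical_cdf p x (y j))) / real q"

text \<open>With the test point fixed, the sum over the reference sample is a count of ranks. The
  two statistics differ by half of at most two depth ties among \<open>p\<close> terms, hence the
  bound \<open>1 / real p\<close>.\<close>

lemma LS_stat_no_ties:
  assumes p: "p > 0" and q: "q > 0" and inj: "inj_on x {..<p}"
    and ne: "\<And>i j. i < p \<Longrightarrow> j < q \<Longrightarrow> x i \<noteq> y j"
  shows "LS_stat_orig tukey_depth p x q y = 2 * mean_empirical_depth p x q y"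
    and "\<bar>LS_stat tukey_depth p x q y - 2 * mean_empirical_depth p x q y\<bar> \<le> 1 / real p"
proof -
  define D where "D v = tukey_depth v (empirical_measure p x)" for v
  define c where "c j = card {i. i < p \<and> x i \<le> y j}" for j
  define d where "d j = min (c j) (p - c j)" for j
  define r where "r i = card {l. l < p \<and> x l \<le> x i}" for i
  have c_le: "c j \<le> p" for j
    using card_mono[of "{..<p}" "{i. i < p \<and> x i \<le> y j}"] by (auto simp: c_def)
  have D_x: "D (x i) = real (min (r i) (p + 1 - r i)) / real p" if "i < p" for i
    unfolding D_def using that p card_ge_rank[OF inj that]
    by (simp add: tukey_depth_empirical_measure r_def of_nat_min)
  have D_y: "D (y j) = real (d j) / real p" if "j < q" for j
  proof -
    \<comment> \<open>A test point is not a reference point, so its half-lines hold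
      \<open>c j\<close> and \<open>p - c j\<close> entries, without the extra 1 of
      \<open>D_x\<close>.\<close>
    have "{l. l < p \<and> x l < y j} = {l. l < p \<and> x l \<le> y j}"
      using ne that by (auto simp: order_less_le)
    then show ?thesis
      unfolding D_def using p
      by (simp add: tukey_depth_empirical_measure card_ge_eq_diff d_def c_def of_nat_min)
  qed
  \<comment> \<open>For odd \<open>p\<close> the middle rank is the one whose depth is attained only
    once, with minimum \<open>(p + 1) / 2\<close>. This bound keeps \<open>d j\<close> below it, so
    the count is \<open>2 * d j\<close> for either parity.\<close>
  have d_le: "2 * d j \<le> p" for j
    by (auto simp: d_def)
  have bij: "bij_betw r {..<p} {1..p}"
    unfolding r_def by (rule bij_betw_rank[OF inj])
  have count: "card {i \<in> {..<p}. Q (r i)} = card {r \<in> {1..p}. Q r}" for Q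
  proof (rule bij_betw_same_card)
    show "bij_betw r {i \<in> {..<p}. Q (r i)} {r \<in> {1..p}. Q r}"
      using bij unfolding bij_betw_def inj_on_def by auto
  qed
  have le: "(\<Sum>i<p. of_bool (D (x i) \<le> D (y j)) :: real) = 2 * real (d j)" if "j < q" for j
  proof -
    have "(\<Sum>i<p. of_bool (D (x i) \<le> D (y j)) :: real)
        = (\<Sum>i<p. of_bool (min (r i) (p + 1 - r i) \<le> d j))"
      using p that by (intro sum.cong refl) (simp add: D_x D_y divide_le_cancel)
    also have "\<dots> = real (card {i \<in> {..<p}. min (r i) (p + 1 - r i) \<le> d j})"
      by (simp add: Int_def)
    finally show ?thesis
      using count[of "\<lambda>r. min r (p + 1 - r) \<le> d j"] card_le_min_rank[OF d_le] by simp
  qed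
  have eq: "(\<Sum>i<p. of_bool (D (x i) = D (y j)) :: real) \<le> 2" if "j < q" for j
  proof -
    have "(\<Sum>i<p. of_bool (D (x i) = D (y j)) :: real)
        = (\<Sum>i<p. of_bool (min (r i) (p + 1 - r i) = d j))"
      using p that by (intro sum.cong refl) (simp add: D_x D_y)
    also have "\<dots> = real (card {i \<in> {..<p}. min (r i) (p + 1 - r i) = d j})"
      by (simp add: Int_def)
    finally show ?thesis
      using count[of "\<lambda>r. min r (p + 1 - r) = d j"] card_eq_min_rank[of p "d j"] by simp
  qed
  have "LS_stat_orig tukey_depth p x q y
      = 1 / (real p * real q) * (\<Sum>j<q. \<Sum>i<p. of_bool (D (x i) \<le> D (y j)))"
    unfolding LS_stat_orig_def D_def by (subst sum.swap) simp
  also have "\<dots> = 1 / (real p * real q) * (\<Sum>j<q. 2 * real (d j))"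
    by (intro arg_cong2[where f = "(*)"] refl sum.cong le) simp
  also have "\<dots> = 2 * mean_empirical_depth p x q y"
  proof -
    have "min (empirical_cdf p x (y j)) (1 - empirical_cdf p x (y j)) = real (d j) / real p" for j
    proof -
      have "1 - empirical_cdf p x (y j) = real (p - c j) / real p"
        using p c_le[of j] by (simp add: empirical_cdf_def c_def of_nat_diff diff_divide_distrib)
      then show ?thesis
        using p by (simp add: empirical_cdf_def d_def of_nat_min min_divide_distrib_right flip: c_def)
    qed
    then show ?thesis
      by (simp add: mean_empirical_depth_def flip: sum_divide_distrib sum_distrib_left)
  qed
  finally show orig: "LS_stat_orig tukey_depth p x q y = 2 * mean_empirical_depth p x q y" .
  \<comment> \<open>Strict comparison plus half a tie equals weak comparison minus half a
    tie.\<close>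
  have "LS_stat tukey_depth p x q y = 1 / (real p * real q) * (\<Sum>j<q. \<Sum>i<p.
      of_bool (D (x i) \<le> D (y j)) - 1 / 2 * of_bool (D (x i) = D (y j)))"
    unfolding LS_stat_def D_def[symmetric]
    by (subst sum.swap) (auto intro!: sum.cong arg_cong2[where f = "(*)"] simp: of_bool_def)
  also have "\<dots> = LS_stat_orig tukey_depth p x q y -
      1 / (real p * real q) * (1 / 2 * (\<Sum>j<q. \<Sum>i<p. of_bool (D (x i) = D (y j))))"
    unfolding LS_stat_orig_def D_def[symmetric]
    by (subst (2) sum.swap) (simp only: sum_subtractf sum_distrib_left[symmetric] right_diff_distrib)
  finally have "\<bar>LS_stat tukey_depth p x q y - LS_stat_orig tukey_depth p x q y\<bar>
      = 1 / (real p * real q) * (1 / 2 * (\<Sum>j<q. \<Sum>i<p. of_bool (D (x i) = D (y j))))"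
    by (simp add: sum_nonneg)
  also have "\<dots> \<le> 1 / (real p * real q) * (1 / 2 * (\<Sum>j<q. 2))"
    by (intro mult_left_mono sum_mono eq) auto
  also have "\<dots> = 1 / real p" using q by simp
  finally show "\<bar>LS_stat tukey_depth p x q y - 2 * mean_empirical_depth p x q y\<bar> \<le> 1 / real p"
    unfolding orig .
qed

text \<open>If \<open>F\<close> and \<open>G\<close> lie on the same side of 1/2, the chosen branch
  is the minimum. Otherwise the error is \<open>\<bar>1 - 2 * G\<bar>\<close>, and since 1/2
  separates \<open>F\<close> from \<open>G\<close> this is exactly
  \<open>2 * \<bar>G - F\<bar> - \<bar>1 - 2 * F\<bar>\<close>.\<close>

lemma abs_min_diff_linearised_le:
  fixes F G :: real
  shows "\<bar>min G (1 - G) - (if F \<le> 1 / 2 then G else 1 - G)\<bar> \<le> max 0 (2 * \<bar>G - F\<bar> - \<bar>1 - 2 * F\<bar>)"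
  by (auto simp: min_def max_def abs_if)

text \<open>Allows the samples, which are functions on all of \<open>nat\<close>, to be replaced by
  their restrictions to the index sets, that is, by points of the product space.\<close>

lemma LS_stat_cong:
  assumes "\<And>i. i < p \<Longrightarrow> x i = x' i" "\<And>j. j < q \<Longrightarrow> y j = y' j"
  shows "LS_stat tukey_depth p x q y = LS_stat tukey_depth p x' q y'"
    and "LS_stat_orig tukey_depth p x q y = LS_stat_orig tukey_depth p x' q y'"
proof -
  have "tukey_depth v (empirical_measure p x) = tukey_depth v (empirical_measure p x')" if "p > 0" for v
    using that assms(1) by (simp add: tukey_depth_empirical_measure cong: conj_cong)
  then show "LS_stat tukey_depth p x q y = LS_stat tukey_depth p x' q y'"
    "LS_stat_orig tukey_depth p x q y = LS_stat_orig tukey_depth p x' q y'"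
    using assms by (cases "p = 0"; simp add: LS_stat_def LS_stat_orig_def)+
qed

lemma real_card_eq_sum: "real (card {i. i < (p::nat) \<and> P i}) = (\<Sum>i<p. of_bool (P i))"
proof -
  have "{i. i < p \<and> P i} = {..<p} \<inter> {i. P i}" by auto
  then show ?thesis by simp
qed

lemma
  fixes \<mu> \<nu> :: "real measure"
  assumes [measurable_cong]: "sets \<mu> = sets borel" "sets \<nu> = sets borel"
  shows measurable_LS_stat: "(\<lambda>z. LS_stat tukey_depth p (fst z) q (snd z))
      \<in> borel_measurable (PiM {..<p} (\<lambda>_. \<mu>) \<Otimes>\<^sub>M PiM {..<q} (\<lambda>_. \<nu>))"
    and measurable_LS_stat_orig: "(\<lambda>z. LS_stat_orig tukey_depth p (fst z) q (snd z))
      \<in> borel_measurable (PiM {..<p} (\<lambda>_. \<mu>) \<Otimes>\<^sub>M PiM {..<q} (\<lambda>_. \<nu>))"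
proof -
  let ?N = "PiM {..<p} (\<lambda>_. \<mu>) \<Otimes>\<^sub>M PiM {..<q} (\<lambda>_. \<nu>)"
  have D: "(\<lambda>z. tukey_depth (v z) (empirical_measure p (fst z))) \<in> borel_measurable ?N"
    if "p > 0" and [measurable]: "v \<in> borel_measurable ?N" for v
    unfolding tukey_depth_empirical_measure[OF \<open>p > 0\<close>] real_card_eq_sum of_bool_def by measurable
  have Dx[measurable]: "(\<lambda>z. tukey_depth (fst z i) (empirical_measure p (fst z))) \<in> borel_measurable ?N"
    if [simp]: "i < p" for i
    by (rule D[OF le_less_trans[OF le0 that]]) simp
  have Dy[measurable]: "(\<lambda>z. tukey_depth (snd z j) (empirical_measure p (fst z))) \<in> borel_measurable ?N"
    if [simp]: "j < q" "p > 0" for j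
    by (rule D) (use that in \<open>auto\<close>)
  have "(\<lambda>z. LS_stat tukey_depth p (fst z) q (snd z)) \<in> borel_measurable ?N"
    "(\<lambda>z. LS_stat_orig tukey_depth p (fst z) q (snd z)) \<in> borel_measurable ?N" if [simp]: "p > 0"
    unfolding LS_stat_def LS_stat_orig_def of_bool_def by measurable
  \<comment> \<open>Without reference points the outer sum is empty and the statistic is constantly
    0; the counting formula for the depth is available for positive \<open>p\<close> only.\<close>
  moreover have "(\<lambda>z. LS_stat tukey_depth p (fst z) q (snd z)) \<in> borel_measurable ?N"
    "(\<lambda>z. LS_stat_orig tukey_depth p (fst z) q (snd z)) \<in> borel_measurable ?N" if "p = 0"
    by (simp_all add: that LS_stat_def LS_stat_orig_def)
  ultimately show "(\<lambda>z. LS_stat tukey_depth p (fst z) q (snd z)) \<in> borel_measurable ?N"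
    "(\<lambda>z. LS_stat_orig tukey_depth p (fst z) q (snd z)) \<in> borel_measurable ?N"
    by (cases "p = 0"; blast)+
qed

subsection \<open>Linearisation at the cumulative distribution function\<close>

lemma integral_iid_component:
  fixes f :: "'a \<Rightarrow> 'b :: {banach, second_countable_topology}"
  assumes "prob_space \<mu>" "i < n" and [measurable]: "f \<in> borel_measurable \<mu>"
  shows "(\<integral>x. f (x i) \<partial>PiM {..<n} (\<lambda>_. \<mu>)) = (\<integral>u. f u \<partial>\<mu>)"
proof -
  have "(\<integral>u. f u \<partial>\<mu>) = (\<integral>u. f u \<partial>distr (PiM {..<n} (\<lambda>_. \<mu>)) \<mu> (\<lambda>x. x i))"
    using assms by (subst distr_PiM_component[where M = "\<lambda>_. \<mu>"]) auto
  also have "\<dots> = (\<integral>x. f (x i) \<partial>PiM {..<n} (\<lambda>_. \<mu>))"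
    using assms(2) by (intro integral_distr) auto
  finally show ?thesis ..
qed

lemma char_iid_sum:
  fixes f :: "'a \<Rightarrow> real"
  assumes "prob_space \<mu>" and [measurable]: "f \<in> borel_measurable \<mu>"
  shows "(CLINT x|PiM {..<n} (\<lambda>_. \<mu>). iexp (s * (\<Sum>i<n. f (x i)))) = (CLINT u|\<mu>. iexp (s * f u)) ^ n"
proof -
  interpret prob_space \<mu> by fact
  interpret product_sigma_finite "\<lambda>_::nat. \<mu>" ..
  have int: "integrable \<mu> (\<lambda>u. iexp (s * f u))"
    by (rule integrable_iexp) auto
  have "(CLINT x|PiM {..<n} (\<lambda>_. \<mu>). iexp (s * (\<Sum>i<n. f (x i))))
      = (CLINT x|PiM {..<n} (\<lambda>_. \<mu>). (\<Prod>i<n. iexp (s * f (x i))))"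
    by (simp add: exp_sum sum_distrib_left)
  also have "\<dots> = (\<Prod>i<n. CLINT u|\<mu>. iexp (s * f u))"
    by (rule product_integral_prod) (use int in auto)
  finally show ?thesis by simp
qed

text \<open>Two distinct coordinates are independent, so their joint law is
  \<open>\<mu> \<Otimes>\<^sub>M \<mu>\<close>, and the diagonal is null there because each of its
  sections is a single point.\<close>

lemma AE_iid_inj_on:
  fixes \<mu> :: "real measure" and n :: nat
  assumes "prob_space \<mu>" and [measurable_cong]: "sets \<mu> = sets borel" and atomless: "\<And>u. AE v in \<mu>. v \<noteq> u"
  shows "AE x in PiM {..<n} (\<lambda>_. \<mu>). inj_on x {..<n}"
proof -
  interpret \<mu>: prob_space \<mu> by fact
  interpret product_prob_space "\<lambda>_::nat. \<mu>" "{..<n}" ..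
  interpret \<mu>\<mu>: pair_prob_space \<mu> \<mu> ..
  have ij: "AE x in PiM {..<n} (\<lambda>_. \<mu>). x i \<noteq> x j" if "i < n" "j < n" "i \<noteq> j" for i j
  proof -
    \<comment> \<open>Points of the product space are already \<open>undefined\<close> off the index
      set, so restriction is the identity on it. The coordinate vector thus has the product of its
      marginals as its law, which is independence.\<close>
    have "distr (PiM {..<n} (\<lambda>_. \<mu>)) (PiM {..<n} (\<lambda>_. \<mu>)) (\<lambda>x. \<lambda>i\<in>{..<n}. x i) = PiM {..<n} (\<lambda>_. \<mu>)"
    proof -
      have "distr (PiM {..<n} (\<lambda>_. \<mu>)) (PiM {..<n} (\<lambda>_. \<mu>)) (\<lambda>x. \<lambda>i\<in>{..<n}. x i)
          = distr (PiM {..<n} (\<lambda>_. \<mu>)) (PiM {..<n} (\<lambda>_. \<mu>)) (\<lambda>x. x)"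
        by (intro distr_cong refl) (simp add: space_PiM PiE_restrict)
      then show ?thesis by (simp add: distr_id2)
    qed
    also have "\<dots> = PiM {..<n} (\<lambda>i. distr (PiM {..<n} (\<lambda>_. \<mu>)) \<mu> (\<lambda>x. x i))"
      by (intro PiM_cong refl distr_PiM_component[symmetric]) (auto intro: \<mu>.prob_space_axioms)
    finally have "indep_vars (\<lambda>_. \<mu>) (\<lambda>i x. x i) {..<n}"
      using that by (subst indep_vars_iff_distr_eq_PiM') auto
    then have "indep_var (PiM {i} (\<lambda>_. \<mu>)) (\<lambda>x. restrict x {i}) (PiM {j} (\<lambda>_. \<mu>)) (\<lambda>x. restrict x {j})"
      using that by (intro indep_var_restrict[of "\<lambda>_. \<mu>" "\<lambda>i x. x i" "{..<n}"]) auto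
    then have "indep_var \<mu> ((\<lambda>x. x i) \<circ> (\<lambda>x. restrict x {i})) \<mu> ((\<lambda>x. x j) \<circ> (\<lambda>x. restrict x {j}))"
      by (rule indep_var_compose) auto
    then have "indep_var \<mu> (\<lambda>x. x i) \<mu> (\<lambda>x. x j)"
      by (simp add: comp_def)
    then have "distr (PiM {..<n} (\<lambda>_. \<mu>)) \<mu> (\<lambda>x. x i) \<Otimes>\<^sub>M distr (PiM {..<n} (\<lambda>_. \<mu>)) \<mu> (\<lambda>x. x j)
        = distr (PiM {..<n} (\<lambda>_. \<mu>)) (\<mu> \<Otimes>\<^sub>M \<mu>) (\<lambda>x. (x i, x j))"
      unfolding indep_var_distribution_eq by simp
    then have eq: "distr (PiM {..<n} (\<lambda>_. \<mu>)) (\<mu> \<Otimes>\<^sub>M \<mu>) (\<lambda>x. (x i, x j)) = \<mu> \<Otimes>\<^sub>M \<mu>"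
      using that \<mu>.prob_space_axioms distr_PiM_component[of "{..<n}" "\<lambda>_. \<mu>"] by simp
    have "AE z in \<mu> \<Otimes>\<^sub>M \<mu>. snd z \<noteq> fst z"
      by (rule \<mu>\<mu>.AE_pair_measure) (measurable, simp add: atomless)
    then have "AE z in distr (PiM {..<n} (\<lambda>_. \<mu>)) (\<mu> \<Otimes>\<^sub>M \<mu>) (\<lambda>x. (x i, x j)). snd z \<noteq> fst z"
      unfolding eq .
    moreover have "(\<lambda>x. (x i, x j)) \<in> PiM {..<n} (\<lambda>_. \<mu>) \<rightarrow>\<^sub>M \<mu> \<Otimes>\<^sub>M \<mu>"
      using that by (intro measurable_Pair measurable_component_singleton) auto
    ultimately have "AE x in PiM {..<n} (\<lambda>_. \<mu>). snd (x i, x j) \<noteq> fst (x i, x j)"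
      by (rule AE_distrD[rotated])
    then show ?thesis by (simp add: eq_commute)
  qed
  have "AE x in PiM {..<n} (\<lambda>_. \<mu>). \<forall>i\<in>{..<n}. \<forall>j\<in>{..<n}. i \<noteq> j \<longrightarrow> x i \<noteq> x j"
    by (intro AE_finite_allI) (auto intro: ij)
  then show ?thesis
    by eventually_elim (auto simp: inj_on_def)
qed

text \<open>\<open>\<mu>\<close> is the law of the reference sample and \<open>\<nu>\<close> that of
  the test sample. Atomlessness of \<open>\<mu>\<close> excludes ties within the reference sample,
  atomlessness of \<open>\<nu>\<close> ties between the two samples.\<close>

locale two_laws =
  fixes \<mu> \<nu> :: "real measure"
  assumes real_distribution_\<mu>: "real_distribution \<mu>" and real_distribution_\<nu>: "real_distribution \<nu>"
    and atomless_\<mu>: "\<And>u. AE v in \<mu>. v \<noteq> u" and atomless_\<nu>: "\<And>u. AE v in \<nu>. v \<noteq> u"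
    and median_null: "AE v in \<nu>. cdf \<mu> v \<noteq> 1 / 2"
begin

sublocale M: real_distribution \<mu> by (rule real_distribution_\<mu>)
sublocale N: real_distribution \<nu> by (rule real_distribution_\<nu>)
sublocale MN: pair_prob_space \<mu> \<nu> ..

abbreviation sample_space :: "nat \<Rightarrow> nat \<Rightarrow> ((nat \<Rightarrow> real) \<times> (nat \<Rightarrow> real)) measure" where
  "sample_space p q \<equiv> PiM {..<p} (\<lambda>_. \<mu>) \<Otimes>\<^sub>M PiM {..<q} (\<lambda>_. \<nu>)"

lemma
  fixes p q :: nat
  shows prob_space_sample_space: "prob_space (sample_space p q)"
  and prob_space_iid_\<mu>: "prob_space (PiM {..<p} (\<lambda>_. \<mu>))"
  and prob_space_iid_\<nu>: "prob_space (PiM {..<q} (\<lambda>_. \<nu>))"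
  by (intro prob_space_pair prob_space_PiM M.prob_space_axioms N.prob_space_axioms)+

lemma pair_prob_space_samples:
  fixes p q :: nat
  shows "pair_prob_space (PiM {..<p} (\<lambda>_. \<mu>)) (PiM {..<q} (\<lambda>_. \<nu>))"
  unfolding pair_prob_space_def pair_sigma_finite_def
  using prob_space_iid_\<mu> prob_space_iid_\<nu>
  by (simp add: prob_space_imp_sigma_finite)

text \<open>
  Averaged over the reference sample, the kernel is \<open>F\<^sub>p v\<close> or \<open>1 - F\<^sub>p v\<close>, whichever branch of
  \<open>min (F\<^sub>p v) (1 - F\<^sub>p v)\<close> is selected by the true distribution function.
\<close>

definition "depth_kernel u v = (of_bool (if cdf \<mu> v \<le> 1 / 2 then u \<le> v else v < u) :: real)"
text \<open>The subscript names the variable that is integrated out: \<open>mean_u\<close> depends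
  on the test point, \<open>mean_v\<close> on the reference point. Centred at
  \<open>\<theta>\<close>, they are the first-order terms of the Hoeffding decomposition.\<close>

definition "mean_u v = (\<integral>u. depth_kernel u v \<partial>\<mu>)"
definition "mean_v u = (\<integral>v. depth_kernel u v \<partial>\<nu>)"
definition "\<theta> = (\<integral>v. mean_u v \<partial>\<nu>)"

lemma measurable_cdf[measurable]: "cdf \<mu> \<in> borel_measurable borel"
  by (intro borel_measurable_mono monoI M.cdf_nondecreasing)

lemma depth_kernel_bounds[simp]:
  shows "0 \<le> depth_kernel u v" "depth_kernel u v \<le> 1"
  by (simp_all add: depth_kernel_def)

lemma measurable_depth_kernel[measurable]: "case_prod depth_kernel \<in> borel_measurable (borel \<Otimes>\<^sub>M borel)"
  unfolding depth_kernel_def of_bool_def case_prod_beta' by measurable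

lemma measurable_depth_kernel'[measurable (raw)]:
  assumes [measurable]: "f \<in> borel_measurable M" "g \<in> borel_measurable M"
  shows "(\<lambda>x. depth_kernel (f x) (g x)) \<in> borel_measurable M"
proof -
  have "(\<lambda>x. case_prod depth_kernel (f x, g x)) \<in> borel_measurable M" by measurable
  then show ?thesis by simp
qed

lemma measurable_mean_u[measurable]: "mean_u \<in> borel_measurable borel"
  unfolding mean_u_def[abs_def] by measurable

lemma measurable_mean_v[measurable]: "mean_v \<in> borel_measurable borel"
  unfolding mean_v_def[abs_def] by measurable

lemma integrable_depth_kernel_u: "integrable \<mu> (\<lambda>u. depth_kernel u v)"
  by (rule M.integrable_const_bound[of _ 1]) auto

lemma integrable_depth_kernel_v: "integrable \<nu> (\<lambda>v. depth_kernel u v)"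
  by (rule N.integrable_const_bound[of _ 1]) auto

lemma mean_u_bounds[simp]: "0 \<le> mean_u v" "mean_u v \<le> 1"
  unfolding mean_u_def by (auto intro!: M.integral_le_const integrable_depth_kernel_u)

lemma mean_v_bounds[simp]: "0 \<le> mean_v u" "mean_v u \<le> 1"
  unfolding mean_v_def by (auto intro!: N.integral_le_const integrable_depth_kernel_v)

lemma integrable_mean_u: "integrable \<nu> mean_u"
  by (rule N.integrable_const_bound[of _ 1]) auto

lemma integrable_mean_v: "integrable \<mu> mean_v"
  by (rule M.integrable_const_bound[of _ 1]) auto

lemma \<theta>_bounds[simp]: "0 \<le> \<theta>" "\<theta> \<le> 1"
  unfolding \<theta>_def by (auto intro!: N.integral_le_const integrable_mean_u)

lemma integral_mean_v: "(\<integral>u. mean_v u \<partial>\<mu>) = \<theta>"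
proof -
  have "integrable (\<mu> \<Otimes>\<^sub>M \<nu>) (case_prod depth_kernel)"
    by (rule MN.integrable_const_bound[of _ 1]) auto
  from MN.Fubini_integral[OF this] show ?thesis
    by (simp add: \<theta>_def mean_u_def mean_v_def)
qed

text \<open>The branch error allowed by \<open>abs_min_diff_linearised_le\<close>. It vanishes
  unless the empirical distribution function is off by more than the distance of
  \<open>cdf \<mu> v\<close> from 1/2.\<close>

definition "excess p x v = max 0 (2 * \<bar>empirical_cdf p x v - cdf \<mu> v\<bar> - \<bar>1 - 2 * cdf \<mu> v\<bar>)"

lemma measurable_empirical_cdf[measurable (raw)]:
  assumes "\<And>i. i < p \<Longrightarrow> (\<lambda>z. x z i) \<in> borel_measurable M" and [measurable]: "v \<in> borel_measurable M"
  shows "(\<lambda>z. empirical_cdf p (x z) (v z)) \<in> borel_measurable M"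
proof -
  have [measurable]: "(\<lambda>z. x z i) \<in> borel_measurable M" if "i \<in> {..<p}" for i
    using assms(1) that by simp
  show ?thesis
    unfolding empirical_cdf_def real_card_eq_sum of_bool_def by measurable
qed

lemma measurable_excess[measurable (raw)]:
  assumes "\<And>i. i < p \<Longrightarrow> (\<lambda>z. x z i) \<in> borel_measurable M" and [measurable]: "v \<in> borel_measurable M"
  shows "(\<lambda>z. excess p (x z) (v z)) \<in> borel_measurable M"
  using measurable_empirical_cdf[OF assms] unfolding excess_def by measurable

lemma empirical_cdf_bounds: "0 \<le> empirical_cdf p x v" "empirical_cdf p x v \<le> 1"
proof -
  have "card {i. i < p \<and> x i \<le> v} \<le> p"
    using card_mono[of "{..<p}" "{i. i < p \<and> x i \<le> v}"] by auto
  then show "0 \<le> empirical_cdf p x v" "empirical_cdf p x v \<le> 1"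
    by (auto simp: empirical_cdf_def divide_le_eq_1)
qed

lemma empirical_cdf_diff_bound: "\<bar>empirical_cdf p x v - cdf \<mu> v\<bar> \<le> 1"
  using empirical_cdf_bounds[of p x v] M.cdf_nonneg[of v] M.cdf_bounded_prob[of v] by linarith

lemma excess_bounds: "0 \<le> excess p x v" "excess p x v \<le> 2"
proof -
  show "0 \<le> excess p x v" by (simp add: excess_def)
  show "excess p x v \<le> 2"
  proof -
    have "2 * D - E \<le> 2" if "D \<le> 1" "0 \<le> E" for D E :: real
      using that by linarith
    from this[OF empirical_cdf_diff_bound abs_ge_zero] show ?thesis
      by (simp add: excess_def)
  qed
qed

text \<open>The sum consists of centred indicators bounded by 1; this crude bound replaces the exact
  variance F (1 - F) / p.\<close>

lemma empirical_cdf_second_moment: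
  assumes "p > 0"
  shows "(\<integral>x. (empirical_cdf p x v - cdf \<mu> v)\<^sup>2 \<partial>PiM {..<p} (\<lambda>_. \<mu>)) \<le> 1 / real p"
proof -
  let ?g = "\<lambda>u. indicator {..v} u - cdf \<mu> v :: real"
  have "\<bar>?g u\<bar> \<le> 1" for u
    using M.cdf_nonneg[of v] M.cdf_bounded_prob[of v] by (auto simp: indicator_def)
  moreover have "(\<integral>u. ?g u \<partial>\<mu>) = 0"
  proof -
    have "integrable \<mu> (indicat_real {..v})"
      by (rule M.integrable_const_bound[of _ 1]) (auto simp: indicator_def)
    then show ?thesis
      using M.prob_space by (simp add: cdf_def)
  qed
  ultimately have "(\<integral>x. (\<Sum>i<p. ?g (x i))\<^sup>2 \<partial>PiM {..<p} (\<lambda>_. \<mu>)) \<le> real p * 1\<^sup>2"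
    by (intro iid_sum_square_le) (auto simp: M.prob_space_axioms)
  moreover have "(empirical_cdf p x v - cdf \<mu> v)\<^sup>2 = (\<Sum>i<p. ?g (x i))\<^sup>2 / (real p)\<^sup>2" for x
  proof -
    have "empirical_cdf p x v - cdf \<mu> v = (\<Sum>i<p. ?g (x i)) / real p"
      unfolding empirical_cdf_def real_card_eq_sum
      using assms by (simp add: sum_subtractf diff_divide_distrib indicator_def of_bool_def)
    then show ?thesis by (simp add: power_divide)
  qed
  ultimately show ?thesis
    using assms by (simp add: divide_le_eq power2_eq_square)
qed

text \<open>Two bounds in one. The first moment of the empirical error gives
  \<open>2 / sqrt (real p)\<close> for every \<open>v\<close>; its second moment gives the faster
  \<open>1 / (real p * w)\<close>, which blows up as \<open>v\<close> nears the median. With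
  \<open>1 / sqrt (real p)\<close> factored out, their minimum is bounded by 2 and tends to 0 for
  fixed \<open>v\<close>.\<close>

lemma expectation_excess_le:
  assumes "p > 0" and "cdf \<mu> v \<noteq> 1 / 2"
  shows "(\<integral>x. excess p x v \<partial>PiM {..<p} (\<lambda>_. \<mu>))
    \<le> min 2 (1 / (sqrt (real p) * \<bar>1 - 2 * cdf \<mu> v\<bar>)) / sqrt (real p)"
proof -
  let ?P = "PiM {..<p} (\<lambda>_. \<mu>)"
  let ?Z = "\<lambda>x. empirical_cdf p x v - cdf \<mu> v"
  interpret P: prob_space ?P by (rule prob_space_iid_\<mu>)
  have [measurable]: "(\<lambda>x. empirical_cdf p x v) \<in> borel_measurable ?P"
    "(\<lambda>x. excess p x v) \<in> borel_measurable ?P"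
    by measurable
  have int: "integrable ?P (\<lambda>x. excess p x v)"
    by (rule P.integrable_const_bound[of _ 2]) (auto simp: excess_bounds)
  have int_Z: "integrable ?P (\<lambda>x. \<bar>?Z x\<bar>)"
    by (rule P.integrable_const_bound[of _ 1]) (auto simp: empirical_cdf_diff_bound)
  have int_Z2: "integrable ?P (\<lambda>x. (?Z x)\<^sup>2)"
    by (rule P.integrable_const_bound[of _ 1]) (auto simp: empirical_cdf_diff_bound abs_square_le_1)
  note second = empirical_cdf_second_moment[OF \<open>p > 0\<close>, of v]
  have "(\<integral>x. \<bar>?Z x\<bar> \<partial>?P) \<le> sqrt (1 / real p)"
    by (rule order_trans[OF P.integral_abs_le_sqrt[OF _ int_Z2] real_sqrt_le_mono[OF second]]) measurable
  moreover have "(\<integral>x. excess p x v \<partial>?P) \<le> (\<integral>x. 2 * \<bar>?Z x\<bar> \<partial>?P)"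
    using int int_Z by (intro integral_mono) (auto simp: excess_def)
  ultimately have 1: "(\<integral>x. excess p x v \<partial>?P) \<le> 2 / sqrt (real p)"
    by (simp add: real_sqrt_divide)
  define w where "w = \<bar>1 - 2 * cdf \<mu> v\<bar>"
  have w: "w > 0" using assms by (simp add: w_def)
  have "excess p x v \<le> (?Z x)\<^sup>2 / w" for x
  proof - \<comment> \<open>\<open>2 z - w \<le> z\<^sup>2 / w\<close>, from \<open>(z - w)\<^sup>2 \<ge> 0\<close>\<close>
    have "0 \<le> (\<bar>?Z x\<bar> - w)\<^sup>2" by simp
    then have "(2 * \<bar>?Z x\<bar> - w) * w \<le> (?Z x)\<^sup>2"
      by (simp add: power2_eq_square algebra_simps)
    then show ?thesis
      using w unfolding excess_def w_def[symmetric] by (simp add: pos_le_divide_eq)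
  qed
  then have "(\<integral>x. excess p x v \<partial>?P) \<le> (\<integral>x. (?Z x)\<^sup>2 / w \<partial>?P)"
    using int int_Z2 by (intro integral_mono) auto
  also have "\<dots> \<le> 1 / real p / w"
    using divide_right_mono[OF second, of w] w by simp
  also have "\<dots> = 1 / (sqrt (real p) * w) / sqrt (real p)"
    by simp
  finally show ?thesis
    using 1 w unfolding w_def by (simp add: min_divide_distrib_right)
qed

definition "\<delta> p = (\<integral>v. min 2 (1 / (sqrt (real p) * \<bar>1 - 2 * cdf \<mu> v\<bar>)) \<partial>\<nu>)"

text \<open>Dominated convergence with the constant 2; \<open>median_null\<close> turns convergence
  off the median into convergence almost everywhere. No rate is claimed: the scaling consumes only
  the factor \<open>1 / sqrt (real p)\<close> kept outside \<open>\<delta>\<close>.\<close>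

lemma \<delta>_tendsto_0: "\<delta> \<longlonglongrightarrow> 0"
proof -
  have "\<delta> \<longlonglongrightarrow> (\<integral>v. 0 \<partial>\<nu>)"
    unfolding \<delta>_def
  proof (rule integral_dominated_convergence[where w = "\<lambda>_. 2"])
    show "AE v in \<nu>. (\<lambda>p. min 2 (1 / (sqrt (real p) * \<bar>1 - 2 * cdf \<mu> v\<bar>))) \<longlonglongrightarrow> 0"
      using median_null
    proof eventually_elim
      case (elim v)
      have "(\<lambda>p. min 2 (1 / (sqrt (real p) * \<bar>1 - 2 * cdf \<mu> v\<bar>))) \<longlonglongrightarrow> min 2 0"
        using elim
        by (intro tendsto_min tendsto_const tendsto_divide_0[OF tendsto_const]
            filterlim_at_top_imp_at_infinity filterlim_at_top_mult_tendsto_pos[OF tendsto_const]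
            filterlim_compose[OF sqrt_at_top] filterlim_real_sequentially) auto
      then show ?case by simp
    qed
  qed auto
  then show ?thesis by simp
qed

lemma \<delta>_nonneg: "0 \<le> \<delta> p"
  unfolding \<delta>_def by (intro integral_nonneg_AE) auto

lemma expectation_sum_excess_le:
  assumes "p > 0"
  shows "(\<integral>z. (\<Sum>j<q. excess p (fst z) (snd z j)) \<partial>sample_space p q) \<le> real q * (\<delta> p / sqrt (real p))"
    and "integrable (sample_space p q) (\<lambda>z. \<Sum>j<q. excess p (fst z) (snd z j))"
proof -
  let ?P = "PiM {..<p} (\<lambda>_. \<mu>)" and ?Q = "PiM {..<q} (\<lambda>_. \<nu>)"
  interpret PQ: pair_prob_space ?P ?Q by (rule pair_prob_space_samples)
  interpret P\<nu>: pair_prob_space ?P \<nu>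
    unfolding pair_prob_space_def pair_sigma_finite_def
    using prob_space_iid_\<mu> N.prob_space_axioms by (simp add: prob_space_imp_sigma_finite)
  have int_j: "integrable (sample_space p q) (\<lambda>z. excess p (fst z) (snd z j))" if [simp]: "j < q" for j
    by (rule PQ.integrable_const_bound[of _ 2]) (auto simp: excess_bounds)
  have int_v: "integrable (?P \<Otimes>\<^sub>M \<nu>) (\<lambda>(x, v). excess p x v)"
    by (rule P\<nu>.integrable_const_bound[of _ 2]) (auto simp: excess_bounds case_prod_beta')
  have meas: "(\<lambda>v. \<integral>x. excess p x v \<partial>?P) \<in> borel_measurable \<nu>"
    using P\<nu>.integrable_snd[OF int_v] by auto
  have int_min: "integrable \<nu> (\<lambda>v. min 2 (1 / (sqrt (real p) * \<bar>1 - 2 * cdf \<mu> v\<bar>)))"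
    by (rule N.integrable_const_bound[of _ 2]) auto
  have each: "(\<integral>z. excess p (fst z) (snd z j) \<partial>sample_space p q) \<le> \<delta> p / sqrt (real p)"
    if [simp]: "j < q" for j
  proof -
    \<comment> \<open>The reference sample is integrated first, with the test point frozen, because
      the bound on the excess holds pointwise in \<open>v\<close>.\<close>
    have "(\<integral>z. excess p (fst z) (snd z j) \<partial>sample_space p q) = (\<integral>y. (\<integral>x. excess p x (y j) \<partial>?P) \<partial>?Q)"
      using PQ.integral_snd[of "\<lambda>x y. excess p x (y j)"] int_j[OF that] by (simp add: case_prod_beta')
    also have "\<dots> = (\<integral>v. (\<integral>x. excess p x v \<partial>?P) \<partial>\<nu>)"
      using meas by (intro integral_iid_component[of \<nu> j q "\<lambda>v. \<integral>x. excess p x v \<partial>?P"])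
        (auto simp: N.prob_space_axioms)
    also have "\<dots> \<le> (\<integral>v. min 2 (1 / (sqrt (real p) * \<bar>1 - 2 * cdf \<mu> v\<bar>)) / sqrt (real p) \<partial>\<nu>)"
    proof (rule integral_mono_AE)
      show "integrable \<nu> (\<lambda>v. \<integral>x. excess p x v \<partial>?P)"
        by (rule P\<nu>.integrable_snd[OF int_v])
      show "AE v in \<nu>. (\<integral>x. excess p x v \<partial>?P)
          \<le> min 2 (1 / (sqrt (real p) * \<bar>1 - 2 * cdf \<mu> v\<bar>)) / sqrt (real p)"
        using median_null by eventually_elim (rule expectation_excess_le[OF \<open>p > 0\<close>])
    qed (use int_min in auto)
    finally show ?thesis by (simp add: \<delta>_def)
  qed
  show "integrable (sample_space p q) (\<lambda>z. \<Sum>j<q. excess p (fst z) (snd z j))"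
    by (intro Bochner_Integration.integrable_sum int_j) auto
  have "(\<integral>z. (\<Sum>j<q. excess p (fst z) (snd z j)) \<partial>sample_space p q)
      = (\<Sum>j<q. \<integral>z. excess p (fst z) (snd z j) \<partial>sample_space p q)"
    by (intro Bochner_Integration.integral_sum int_j) auto
  also have "\<dots> \<le> (\<Sum>j<q. \<delta> p / sqrt (real p))"
    by (intro sum_mono each) auto
  finally show "(\<integral>z. (\<Sum>j<q. excess p (fst z) (snd z j)) \<partial>sample_space p q) \<le> real q * (\<delta> p / sqrt (real p))"
    by simp
qed

end

subsection \<open>Projection and asymptotic normality\<close>

context two_laws begin

lemma AE_no_ties:
  fixes p q :: nat
  shows "AE z in sample_space p q. inj_on (fst z) {..<p} \<and> (\<forall>i\<in>{..<p}. \<forall>j\<in>{..<q}. fst z i \<noteq> snd z j)"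
proof -
  let ?P = "PiM {..<p} (\<lambda>_. \<mu>)" and ?Q = "PiM {..<q} (\<lambda>_. \<nu>)"
  interpret PQ: pair_prob_space ?P ?Q by (rule pair_prob_space_samples)
  have "AE x in distr (sample_space p q) ?P fst. inj_on x {..<p}"
    unfolding PQ.M2.distr_pair_fst using atomless_\<mu> by (intro AE_iid_inj_on) (auto simp: M.prob_space_axioms)
  then have 1: "AE z in sample_space p q. inj_on (fst z) {..<p}"
    by (rule AE_distrD[rotated]) simp
  have "AE z in sample_space p q. fst z i \<noteq> snd z j" if ij[simp]: "i < p" "j < q" for i j
  proof (rule PQ.AE_pair_measure)
    have "AE y in ?Q. y j \<noteq> u" for u
      using AE_PiM_component[of "{..<q}" "\<lambda>_. \<nu>" j "\<lambda>v. v \<noteq> u"] atomless_\<nu> N.prob_space_axioms by simp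
    then show "AE x in ?P. AE y in ?Q. fst (x, y) i \<noteq> snd (x, y) j"
      by (auto simp: eq_commute)
    show "{z \<in> space (sample_space p q). fst z i \<noteq> snd z j} \<in> sets (sample_space p q)"
      by (rule borel_measurable_neq) measurable
  qed
  then have "AE z in sample_space p q. \<forall>i\<in>{..<p}. \<forall>j\<in>{..<q}. fst z i \<noteq> snd z j"
    by (intro AE_finite_allI) auto
  with 1 show ?thesis by eventually_elim simp
qed

text \<open>The second branch of the kernel is strict, hence the exact complement of the first; the
  identity holds even when \<open>v\<close> is an entry of \<open>x\<close>.\<close>

lemma sum_depth_kernel:
  assumes "p > 0"
  shows "(\<Sum>i<p. depth_kernel (x i) v) / real p =
    (if cdf \<mu> v \<le> 1 / 2 then empirical_cdf p x v else 1 - empirical_cdf p x v)"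
proof (cases "cdf \<mu> v \<le> 1 / 2")
  case True
  then show ?thesis by (simp add: empirical_cdf_def real_card_eq_sum depth_kernel_def)
next
  case False
  have "(\<Sum>i<p. depth_kernel (x i) v) = (\<Sum>i<p. 1 - of_bool (x i \<le> v))"
    using False by (intro sum.cong refl) (auto simp: depth_kernel_def)
  also have "\<dots> = real p - (\<Sum>i<p. of_bool (x i \<le> v))"
    by (simp add: sum_subtractf)
  finally show ?thesis
    using False assms by (simp add: empirical_cdf_def real_card_eq_sum diff_divide_distrib)
qed

lemma mean_empirical_depth_approx:
  assumes "p > 0" "q > 0"
  shows "\<bar>mean_empirical_depth p x q y - (\<Sum>i<p. \<Sum>j<q. depth_kernel (x i) (y j)) / (real p * real q)\<bar>
    \<le> (\<Sum>j<q. excess p x (y j)) / real q"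
proof -
  let ?G = "\<lambda>j. empirical_cdf p x (y j)"
  have "(\<Sum>i<p. \<Sum>j<q. depth_kernel (x i) (y j)) / (real p * real q)
      = (\<Sum>j<q. (\<Sum>i<p. depth_kernel (x i) (y j)) / real p) / real q"
    by (subst sum.swap) (simp add: sum_divide_distrib)
  then have "mean_empirical_depth p x q y - (\<Sum>i<p. \<Sum>j<q. depth_kernel (x i) (y j)) / (real p * real q)
      = (\<Sum>j<q. min (?G j) (1 - ?G j) - (if cdf \<mu> (y j) \<le> 1 / 2 then ?G j else 1 - ?G j)) / real q"
    using assms by (simp add: mean_empirical_depth_def sum_depth_kernel sum_subtractf diff_divide_distrib)
  moreover have "\<bar>\<Sum>j<q. min (?G j) (1 - ?G j) - (if cdf \<mu> (y j) \<le> 1 / 2 then ?G j else 1 - ?G j)\<bar>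
      \<le> (\<Sum>j<q. excess p x (y j))"
    unfolding excess_def by (intro sum_abs[THEN order_trans] sum_mono abs_min_diff_linearised_le)
  ultimately show ?thesis
    by (simp add: abs_divide divide_right_mono)
qed

text \<open>The second-order Hoeffding remainder. Both of its partial means vanish, so distinct
  summands of its double sum are uncorrelated.\<close>

definition "degenerate_kernel u v = depth_kernel u v - mean_u v - mean_v u + \<theta>"

lemma degenerate_kernel_bound: "\<bar>degenerate_kernel u v\<bar> \<le> 2"
  using depth_kernel_bounds[of u v] mean_u_bounds[of v] mean_v_bounds[of u] \<theta>_bounds
  unfolding degenerate_kernel_def by linarith

lemma measurable_degenerate_kernel[measurable (raw)]:
  assumes [measurable]: "f \<in> borel_measurable M" "g \<in> borel_measurable M"
  shows "(\<lambda>x. degenerate_kernel (f x) (g x)) \<in> borel_measurable M"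
  unfolding degenerate_kernel_def by measurable

lemma integral_degenerate_kernel_u: "(\<integral>u. degenerate_kernel u v \<partial>\<mu>) = 0"
  unfolding degenerate_kernel_def
  using M.prob_space by (simp add: integrable_depth_kernel_u integrable_mean_v integral_mean_v mean_u_def[symmetric])

lemma integral_degenerate_kernel_v: "(\<integral>v. degenerate_kernel u v \<partial>\<nu>) = 0"
  unfolding degenerate_kernel_def
  using N.prob_space by (simp add: integrable_depth_kernel_v integrable_mean_u \<theta>_def[symmetric] mean_v_def[symmetric])

text \<open>The Hajek projection of twice the two-sample U-statistic with kernel
  \<open>depth_kernel\<close>, centred at \<open>2 * \<theta>\<close>.\<close>

definition "projection p q z =
  2 / real q * (\<Sum>j<q. mean_u (snd z j) - \<theta>) + 2 / real p * (\<Sum>i<p. mean_v (fst z i) - \<theta>)"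

lemma depth_kernel_decomposition:
  assumes "p > 0" "q > 0"
  shows "2 * (\<Sum>i<p. \<Sum>j<q. depth_kernel (fst z i) (snd z j)) / (real p * real q) - 2 * \<theta>
    = projection p q z + 2 * (\<Sum>i<p. \<Sum>j<q. degenerate_kernel (fst z i) (snd z j)) / (real p * real q)"
proof -
  let ?A = "\<Sum>j<q. mean_u (snd z j)" and ?B = "\<Sum>i<p. mean_v (fst z i)"
  let ?K = "\<Sum>i<p. \<Sum>j<q. depth_kernel (fst z i) (snd z j)"
  have "(\<Sum>i<p. \<Sum>j<q. degenerate_kernel (fst z i) (snd z j))
      = ?K - real p * ?A - real q * ?B + real p * real q * \<theta>"
    by (simp add: degenerate_kernel_def sum.distrib sum_subtractf sum_distrib_left)
  moreover have "projection p q z = 2 / real q * (?A - real q * \<theta>) + 2 / real p * (?B - real p * \<theta>)"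
    by (simp add: projection_def sum_subtractf)
  ultimately show ?thesis
    using assms by (simp add: field_simps)
qed

lemma measurable_projection[measurable]: "projection p q \<in> borel_measurable (sample_space p q)"
  unfolding projection_def[abs_def] by measurable

text \<open>One term per approximation: depth ties, choice of branch, and the degenerate part, whose
  4 is the factor 2 of the statistic times the bound 2 on \<open>degenerate_kernel\<close>.
  Multiplied by \<open>sqrt (real p)\<close>, each of them tends to 0 as both sizes grow.\<close>

lemma projection_L1_approx:
  assumes p: "p > 0" and q: "q > 0" and T[measurable]: "T \<in> borel_measurable (sample_space p q)"
    and near: "AE z in sample_space p q. \<bar>T z - 2 * mean_empirical_depth p (fst z) q (snd z)\<bar> \<le> 1 / real p"
  shows "integrable (sample_space p q) (\<lambda>z. \<bar>T z - 2 * \<theta> - projection p q z\<bar>)"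
    and "(\<integral>z. \<bar>T z - 2 * \<theta> - projection p q z\<bar> \<partial>sample_space p q)
      \<le> 1 / real p + 2 * \<delta> p / sqrt (real p) + 4 / sqrt (real p * real q)"
proof -
  interpret PQ: prob_space "sample_space p q" by (rule prob_space_sample_space)
  let ?E = "\<lambda>z. \<Sum>j<q. excess p (fst z) (snd z j)"
  let ?H = "\<lambda>z. \<Sum>i<p. \<Sum>j<q. degenerate_kernel (fst z i) (snd z j)"
  let ?bound = "\<lambda>z. 1 / real p + 2 / real q * ?E z + 2 / (real p * real q) * \<bar>?H z\<bar>"
  note E = expectation_sum_excess_le[OF p, of q]
  have H_bnd: "\<bar>?H z\<bar> \<le> real p * (real q * 2)" for z
    using sum_abs_le_card_mult[of "{..<p}" "\<lambda>i. \<Sum>j<q. degenerate_kernel (fst z i) (snd z j)" "real q * 2"]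
      sum_abs_le_card_mult[of "{..<q}" "\<lambda>j. degenerate_kernel (fst z i) (snd z j)" 2 for i]
      degenerate_kernel_bound
    by simp
  have int_H: "integrable (sample_space p q) (\<lambda>z. \<bar>?H z\<bar>)"
    by (rule PQ.integrable_const_bound[of _ "real p * (real q * 2)"])
      (simp_all only: real_norm_def abs_abs H_bnd AE_I2, measurable)
  have int_bound: "integrable (sample_space p q) ?bound"
    using E(2) int_H by simp
  have AE_le: "AE z in sample_space p q. \<bar>T z - 2 * \<theta> - projection p q z\<bar> \<le> ?bound z"
    using near
  proof eventually_elim
    case (elim z)
    let ?m = "mean_empirical_depth p (fst z) q (snd z)"
    let ?K = "(\<Sum>i<p. \<Sum>j<q. depth_kernel (fst z i) (snd z j)) / (real p * real q)"
    have "T z - 2 * \<theta> - projection p q z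
        = (T z - 2 * ?m) + 2 * (?m - ?K) + 2 / (real p * real q) * ?H z"
      using depth_kernel_decomposition[OF p q, of z] by simp
    moreover have "\<bar>2 / (real p * real q) * ?H z\<bar> = 2 / (real p * real q) * \<bar>?H z\<bar>"
      by (simp add: abs_mult)
    moreover have "2 * \<bar>?m - ?K\<bar> \<le> 2 / real q * ?E z"
      using mean_empirical_depth_approx[OF p q, of "fst z" "snd z"] by simp
    moreover have "\<bar>t\<bar> \<le> e1 + e2 + e3"
      if "t = a + 2 * b + h" "\<bar>h\<bar> = e3" "2 * \<bar>b\<bar> \<le> e2" "\<bar>a\<bar> \<le> e1" for t a b h e1 e2 e3 :: real
      using that by linarith
    ultimately show ?case using elim by blast
  qed
  show int: "integrable (sample_space p q) (\<lambda>z. \<bar>T z - 2 * \<theta> - projection p q z\<bar>)"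
  proof (rule Bochner_Integration.integrable_bound[OF int_bound])
    show "AE z in sample_space p q. norm \<bar>T z - 2 * \<theta> - projection p q z\<bar> \<le> norm (?bound z)"
      using AE_le unfolding real_norm_def abs_abs
      by eventually_elim (erule order_trans, rule abs_ge_self)
  qed measurable
  have "(\<integral>z. \<bar>T z - 2 * \<theta> - projection p q z\<bar> \<partial>sample_space p q) \<le> (\<integral>z. ?bound z \<partial>sample_space p q)"
    by (rule integral_mono_AE[OF int int_bound AE_le])
  also have "\<dots> = 1 / real p + 2 / real q * (\<integral>z. ?E z \<partial>sample_space p q)
      + 2 / (real p * real q) * (\<integral>z. \<bar>?H z\<bar> \<partial>sample_space p q)"
    using E(2) int_H PQ.prob_space by simp
  also have "\<dots> \<le> 1 / real p + 2 / real q * (real q * (\<delta> p / sqrt (real p)))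
      + 2 / (real p * real q) * (2 * sqrt (real p * real q))"
    by (intro add_mono mult_left_mono E(1) order_refl degenerate_kernel_sum_le)
      (auto simp: M.prob_space_axioms N.prob_space_axioms degenerate_kernel_bound
        integral_degenerate_kernel_u integral_degenerate_kernel_v case_prod_beta')
  also have "\<dots> = 1 / real p + 2 * \<delta> p / sqrt (real p) + 4 / sqrt (real p * real q)"
  proof -
    have "sqrt (real p * real q) / (real p * real q) = 1 / sqrt (real p * real q)"
      using p q by (simp add: real_div_sqrt field_simps)
    then show ?thesis using q by (simp add: mult.assoc)
  qed
  finally show "(\<integral>z. \<bar>T z - 2 * \<theta> - projection p q z\<bar> \<partial>sample_space p q)
      \<le> 1 / real p + 2 * \<delta> p / sqrt (real p) + 4 / sqrt (real p * real q)" .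
qed

section \<open>Convergence of the characteristic functions\<close>

lemma char_projection:
  "(CLINT z|sample_space p q. iexp (s * projection p q z))
    = (CLINT v|\<nu>. iexp (2 * s / real q * (mean_u v - \<theta>))) ^ q
      * (CLINT u|\<mu>. iexp (2 * s / real p * (mean_v u - \<theta>))) ^ p"
proof -
  let ?P = "PiM {..<p} (\<lambda>_. \<mu>)" and ?Q = "PiM {..<q} (\<lambda>_. \<nu>)"
  interpret PQ: pair_prob_space ?P ?Q by (rule pair_prob_space_samples)
  define A where "A y = 2 * s / real q * (\<Sum>j<q. mean_u (y j) - \<theta>)" for y
  define B where "B x = 2 * s / real p * (\<Sum>i<p. mean_v (x i) - \<theta>)" for x
  have [measurable]: "A \<in> borel_measurable ?Q" "B \<in> borel_measurable ?P"
    unfolding A_def[abs_def] B_def[abs_def] by measurable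
  have int: "integrable (sample_space p q) (\<lambda>z. iexp (B (fst z) + A (snd z)))"
    by (rule PQ.integrable_iexp) auto
  have "(CLINT z|sample_space p q. iexp (s * projection p q z))
      = (CLINT z|sample_space p q. iexp (B (fst z) + A (snd z)))"
    by (intro Bochner_Integration.integral_cong refl) (simp add: projection_def A_def B_def algebra_simps)
  also have "\<dots> = (CLINT x|?P. CLINT y|?Q. iexp (B x + A y))"
    using PQ.integral_fst'[OF int] by simp
  also have "\<dots> = (CLINT x|?P. iexp (B x) * (CLINT y|?Q. iexp (A y)))"
    by (simp add: distrib_left exp_add)
  also have "\<dots> = (CLINT x|?P. iexp (B x)) * (CLINT y|?Q. iexp (A y))"
    by simp
  finally have "(CLINT z|sample_space p q. iexp (s * projection p q z))
      = (CLINT x|?P. iexp (B x)) * (CLINT y|?Q. iexp (A y))" .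
  moreover have "(CLINT y|?Q. iexp (A y)) = (CLINT v|\<nu>. iexp (2 * s / real q * (mean_u v - \<theta>))) ^ q"
    unfolding A_def by (rule char_iid_sum[OF N.prob_space_axioms]) measurable
  moreover have "(CLINT x|?P. iexp (B x)) = (CLINT u|\<mu>. iexp (2 * s / real p * (mean_v u - \<theta>))) ^ p"
    unfolding B_def by (rule char_iid_sum[OF M.prob_space_axioms]) measurable
  ultimately show ?thesis by (simp only: mult.commute)
qed

lemma inverse_sqrt_tendsto_0:
  assumes "filterlim f at_top sequentially"
  shows "(\<lambda>k. 1 / sqrt (real (f k))) \<longlonglongrightarrow> 0"
  by (rule tendsto_divide_0[OF tendsto_const filterlim_at_top_imp_at_infinity])
    (rule filterlim_compose[OF sqrt_at_top filterlim_compose[OF filterlim_real_sequentially assms]])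

text \<open>The statistic enters only through \<open>near\<close>, so one proof covers
  \<open>LS_stat\<close> and \<open>LS_stat_orig\<close>. Levy continuity reduces the claim to the
  product of characteristic functions in \<open>char_projection\<close>, up to an error controlled
  by \<open>projection_L1_approx\<close>.\<close>

theorem depth_statistic_weak_conv:
  fixes p q :: "nat \<Rightarrow> nat" and T :: "nat \<Rightarrow> (nat \<Rightarrow> real) \<times> (nat \<Rightarrow> real) \<Rightarrow> real"
  assumes p: "filterlim p at_top sequentially" and q: "filterlim q at_top sequentially"
    and \<rho>: "(\<lambda>k. real (p k) / (real (p k) + real (q k))) \<longlonglongrightarrow> \<rho>"
    and T[measurable]: "\<And>k. T k \<in> borel_measurable (sample_space (p k) (q k))"
    and near: "\<And>k. p k > 0 \<Longrightarrow> q k > 0 \<Longrightarrow> AE z in sample_space (p k) (q k).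
      \<bar>T k z - 2 * mean_empirical_depth (p k) (fst z) (q k) (snd z)\<bar> \<le> 1 / real (p k)"
    and \<sigma>_u: "(\<integral>v. (mean_u v - \<theta>)\<^sup>2 \<partial>\<nu>) = \<sigma>_u" and \<sigma>_v: "(\<integral>u. (mean_v u - \<theta>)\<^sup>2 \<partial>\<mu>) = \<sigma>_v"
    and V: "48 * (\<rho> * \<sigma>_u + (1 - \<rho>) * \<sigma>_v) = V" "V > 0"
  shows "weak_conv_m (\<lambda>k. distr (sample_space (p k) (q k)) borel
      (\<lambda>z. sqrt (12 * real (p k) * real (q k) / (real (p k) + real (q k))) * (T k z - 2 * \<theta>)))
    (normal_distribution 0 V)"
proof -
  define c where "c k = sqrt (12 * real (p k) * real (q k) / (real (p k) + real (q k)))" for k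
  have p': "eventually (\<lambda>k. p k > 0) sequentially" and q': "eventually (\<lambda>k. q k > 0) sequentially"
    using p[unfolded filterlim_at_top, rule_format, of 1] q[unfolded filterlim_at_top, rule_format, of 1]
    by (simp_all add: Suc_le_eq)
  have inv_p: "(\<lambda>k. 1 / sqrt (real (p k))) \<longlonglongrightarrow> 0" and inv_q: "(\<lambda>k. 1 / sqrt (real (q k))) \<longlonglongrightarrow> 0"
    using inverse_sqrt_tendsto_0[OF p] inverse_sqrt_tendsto_0[OF q] by blast+
  have c_nonneg: "c k \<ge> 0" for k by (simp add: c_def)
  \<comment> \<open>Both shares \<open>q / (p + q)\<close> and \<open>p / (p + q)\<close> are at
    most 1. The first bound absorbs the error terms and the frequency on the reference sample, the
    second the frequency on the test sample.\<close>
  have c_p: "c k \<le> sqrt 12 * sqrt (real (p k))" and c_q: "c k \<le> sqrt 12 * sqrt (real (q k))"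
    if "p k > 0" "q k > 0" for k
    unfolding c_def real_sqrt_mult[symmetric] using that
    by (auto intro!: real_sqrt_le_mono simp: divide_le_eq algebra_simps)
  have c_sq: "(c k)\<^sup>2 = 12 * real (p k) * real (q k) / (real (p k) + real (q k))" for k
    by (simp add: c_def)
  define S where "S k t = (CLINT z|sample_space (p k) (q k). iexp (t * (c k * projection (p k) (q k) z)))" for k t
  have "weak_conv_m (\<lambda>k. distr (sample_space (p k) (q k)) borel (\<lambda>z. c k * (T k z - 2 * \<theta>)))
      (normal_distribution 0 V)"
  proof (rule levy_continuity)
    show "real_distribution (normal_distribution 0 V)"
      by (rule char_normal_distribution) fact
    show "real_distribution (distr (sample_space (p k) (q k)) borel (\<lambda>z. c k * (T k z - 2 * \<theta>)))" for k
      by (intro prob_space.real_distribution_distr prob_space_sample_space) measurable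
    show "(\<lambda>k. char (distr (sample_space (p k) (q k)) borel (\<lambda>z. c k * (T k z - 2 * \<theta>))) t)
        \<longlonglongrightarrow> char (normal_distribution 0 V) t" for t
    proof -
      \<comment> \<open>The frequencies at which the characteristic functions of one test point and
        one reference point are evaluated.\<close>
      let ?s = "\<lambda>k. 2 * (t * c k) / real (q k)" and ?r = "\<lambda>k. 2 * (t * c k) / real (p k)"
      have "(\<lambda>k. 2 * \<bar>t\<bar> * sqrt 12 * (1 / sqrt (real (q k)))) \<longlonglongrightarrow> 0"
        "(\<lambda>k. 2 * \<bar>t\<bar> * sqrt 12 * (1 / sqrt (real (p k)))) \<longlonglongrightarrow> 0"
        using tendsto_mult_right_zero[OF inv_q] tendsto_mult_right_zero[OF inv_p] by blast+
      moreover have "eventually (\<lambda>k. norm (?s k) \<le> 2 * \<bar>t\<bar> * sqrt 12 * (1 / sqrt (real (q k)))) sequentially"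
        using p' q'
      proof eventually_elim
        case (elim k)
        have "norm (?s k) = 2 * \<bar>t\<bar> * c k / (sqrt (real (q k)) * sqrt (real (q k)))"
          using c_nonneg[of k] by (simp add: abs_mult abs_divide)
        also have "\<dots> \<le> 2 * \<bar>t\<bar> * (sqrt 12 * sqrt (real (q k))) / (sqrt (real (q k)) * sqrt (real (q k)))"
          by (intro divide_right_mono mult_left_mono c_q elim) auto
        also have "\<dots> = 2 * \<bar>t\<bar> * sqrt 12 * (1 / sqrt (real (q k)))"
          using elim by (simp add: field_simps)
        finally show ?case .
      qed
      moreover have "eventually (\<lambda>k. norm (?r k) \<le> 2 * \<bar>t\<bar> * sqrt 12 * (1 / sqrt (real (p k)))) sequentially"
        using p' q'
      proof eventually_elim
        case (elim k)
        have "norm (?r k) = 2 * \<bar>t\<bar> * c k / (sqrt (real (p k)) * sqrt (real (p k)))"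
          using c_nonneg[of k] by (simp add: abs_mult abs_divide)
        also have "\<dots> \<le> 2 * \<bar>t\<bar> * (sqrt 12 * sqrt (real (p k))) / (sqrt (real (p k)) * sqrt (real (p k)))"
          by (intro divide_right_mono mult_left_mono c_p elim) auto
        also have "\<dots> = 2 * \<bar>t\<bar> * sqrt 12 * (1 / sqrt (real (p k)))"
          using elim by (simp add: field_simps)
        finally show ?case .
      qed
      ultimately have s0: "?s \<longlonglongrightarrow> 0" and r0: "?r \<longlonglongrightarrow> 0"
        by (auto intro: Lim_null_comparison)
      \<comment> \<open>\<open>q * (2 * t * c / q)\<^sup>2\<close> is
        \<open>4 * t\<^sup>2 * c\<^sup>2 / q\<close>, and \<open>c\<^sup>2 / q\<close> is 12 times
        the share of the reference sample.\<close>
      have "eventually (\<lambda>k. 48 * t\<^sup>2 * (real (p k) / (real (p k) + real (q k))) = real (q k) * (?s k)\<^sup>2) sequentially"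
        using p' q' by eventually_elim (simp add: power_divide power_mult_distrib c_sq power2_eq_square[of "real (q _)"])
      from Lim_transform_eventually[OF tendsto_mult_left[OF \<rho>] this]
      have sL: "(\<lambda>k. real (q k) * (?s k)\<^sup>2) \<longlonglongrightarrow> 48 * t\<^sup>2 * \<rho>" .
      have "eventually (\<lambda>k. 48 * t\<^sup>2 * (1 - real (p k) / (real (p k) + real (q k))) = real (p k) * (?r k)\<^sup>2) sequentially"
        using p' q'
      proof eventually_elim
        case (elim k)
        have "1 - real (p k) / (real (p k) + real (q k)) = real (q k) / (real (p k) + real (q k))"
          using elim by (simp add: field_simps)
        then show ?case
          using elim by (simp add: power_divide power_mult_distrib c_sq power2_eq_square[of "real (p _)"])
      qed
      from Lim_transform_eventually[OF tendsto_mult_left[OF tendsto_diff[OF tendsto_const \<rho>]] this]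
      have rL: "(\<lambda>k. real (p k) * (?r k)\<^sup>2) \<longlonglongrightarrow> 48 * t\<^sup>2 * (1 - \<rho>)" .
      have u_bnd: "\<bar>mean_u v - \<theta>\<bar> \<le> 1" and v_bnd: "\<bar>mean_v v - \<theta>\<bar> \<le> 1" for v
        using mean_u_bounds[of v] mean_v_bounds[of v] \<theta>_bounds by linarith+
      have u_mean: "(\<integral>v. mean_u v - \<theta> \<partial>\<nu>) = 0" and v_mean: "(\<integral>u. mean_v u - \<theta> \<partial>\<mu>) = 0"
        using M.prob_space N.prob_space
        by (simp_all add: integrable_mean_u integrable_mean_v integral_mean_v \<theta>_def[symmetric])
      have "(\<lambda>k. (CLINT v|\<nu>. iexp (?s k * (mean_u v - \<theta>))) ^ q k) \<longlonglongrightarrow> exp (- (\<sigma>_u * (48 * t\<^sup>2 * \<rho>)) / 2)"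
        using u_bnd by (intro N.char_power_tendsto[OF _ _ u_mean \<sigma>_u s0 sL]) auto
      moreover have "(\<lambda>k. (CLINT u|\<mu>. iexp (?r k * (mean_v u - \<theta>))) ^ p k) \<longlonglongrightarrow> exp (- (\<sigma>_v * (48 * t\<^sup>2 * (1 - \<rho>))) / 2)"
        using v_bnd by (intro M.char_power_tendsto[OF _ _ v_mean \<sigma>_v r0 rL]) auto
      ultimately have "(\<lambda>k. (CLINT v|\<nu>. iexp (?s k * (mean_u v - \<theta>))) ^ q k
          * (CLINT u|\<mu>. iexp (?r k * (mean_v u - \<theta>))) ^ p k) \<longlonglongrightarrow>
          complex_of_real (exp (- (\<sigma>_u * (48 * t\<^sup>2 * \<rho>)) / 2)) * complex_of_real (exp (- (\<sigma>_v * (48 * t\<^sup>2 * (1 - \<rho>))) / 2))"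
        by (rule tendsto_mult)
      moreover have "S k t = (CLINT v|\<nu>. iexp (?s k * (mean_u v - \<theta>))) ^ q k
          * (CLINT u|\<mu>. iexp (?r k * (mean_v u - \<theta>))) ^ p k" for k
        using char_projection[of "p k" "q k" "t * c k"] by (simp only: S_def mult.assoc)
      ultimately have "(\<lambda>k. S k t) \<longlonglongrightarrow>
          complex_of_real (exp (- (\<sigma>_u * (48 * t\<^sup>2 * \<rho>)) / 2)) * complex_of_real (exp (- (\<sigma>_v * (48 * t\<^sup>2 * (1 - \<rho>))) / 2))"
        by simp
      moreover have "exp (- (\<sigma>_u * (48 * t\<^sup>2 * \<rho>)) / 2) * exp (- (\<sigma>_v * (48 * t\<^sup>2 * (1 - \<rho>))) / 2) = exp (- (V * t\<^sup>2) / 2)"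
        unfolding V(1)[symmetric] exp_add[symmetric] by (simp add: field_simps)
      ultimately have S_lim: "(\<lambda>k. S k t) \<longlonglongrightarrow> char (normal_distribution 0 V) t"
        by (simp add: char_normal_distribution[OF V(2)] flip: of_real_mult)
      have "eventually (\<lambda>k. cmod (char (distr (sample_space (p k) (q k)) borel (\<lambda>z. c k * (T k z - 2 * \<theta>))) t - S k t)
          \<le> \<bar>t\<bar> * sqrt 12 * (1 / sqrt (real (p k)) + 2 * \<delta> (p k) + 4 * (1 / sqrt (real (q k))))) sequentially"
        using p' q'
      proof eventually_elim
        case (elim k)
        interpret PQ: prob_space "sample_space (p k) (q k)" by (rule prob_space_sample_space)
        let ?D = "\<lambda>z. \<bar>T k z - 2 * \<theta> - projection (p k) (q k) z\<bar>"
        note L1 = projection_L1_approx[OF elim(1) elim(2) T near[OF elim]]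
        have D: "\<bar>c k * (T k z - 2 * \<theta>) - c k * projection (p k) (q k) z\<bar> = c k * ?D z" for z
          using c_nonneg[of k] by (simp add: abs_mult flip: right_diff_distrib)
        have "cmod (char (distr (sample_space (p k) (q k)) borel (\<lambda>z. c k * (T k z - 2 * \<theta>))) t - S k t)
            \<le> \<bar>t\<bar> * (\<integral>z. c k * ?D z \<partial>sample_space (p k) (q k))"
          using PQ.cmod_integral_iexp_diff_le[of "\<lambda>z. c k * (T k z - 2 * \<theta>)" "\<lambda>z. c k * projection (p k) (q k) z" t]
            L1(1)
          by (simp add: D S_def char_def integral_distr)
        also have "\<dots> \<le> \<bar>t\<bar> * (c k * (1 / real (p k) + 2 * \<delta> (p k) / sqrt (real (p k)) + 4 / sqrt (real (p k) * real (q k))))"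
          using L1 c_nonneg[of k] by (simp add: mult_left_mono)
        also have "\<dots> \<le> \<bar>t\<bar> * (sqrt 12 * sqrt (real (p k)) * (1 / real (p k) + 2 * \<delta> (p k) / sqrt (real (p k)) + 4 / sqrt (real (p k) * real (q k))))"
          using \<delta>_nonneg[of "p k"] by (intro mult_left_mono mult_right_mono c_p elim) auto
        also have "\<dots> = \<bar>t\<bar> * sqrt 12 * (1 / sqrt (real (p k)) + 2 * \<delta> (p k) + 4 * (1 / sqrt (real (q k))))"
        proof -
          have "sqrt (real (p k)) * (1 / real (p k) + 2 * \<delta> (p k) / sqrt (real (p k)) + 4 / sqrt (real (p k) * real (q k)))
              = 1 / sqrt (real (p k)) + 2 * \<delta> (p k) + 4 * (1 / sqrt (real (q k)))"
            using elim by (simp add: distrib_left real_sqrt_mult) (simp add: real_div_sqrt field_simps)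
          then show ?thesis by (simp only: mult.assoc)
        qed
        finally show ?case .
      qed
      moreover have "(\<lambda>k. \<bar>t\<bar> * sqrt 12 * (1 / sqrt (real (p k)) + 2 * \<delta> (p k) + 4 * (1 / sqrt (real (q k))))) \<longlonglongrightarrow>
          \<bar>t\<bar> * sqrt 12 * (0 + 2 * 0 + 4 * 0)"
        by (intro tendsto_intros inv_p inv_q filterlim_compose[OF \<delta>_tendsto_0 p])
      ultimately have "(\<lambda>k. char (distr (sample_space (p k) (q k)) borel (\<lambda>z. c k * (T k z - 2 * \<theta>))) t - S k t) \<longlonglongrightarrow> 0"
        by (auto intro: Lim_null_comparison)
      from Lim_transform[OF S_lim this] show ?thesis .
    qed
  qed
  then show ?thesis by (simp only: c_def)
qed

end

subsection \<open>Transfer to independent samples\<close>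

text \<open>Independence of the two vectors says that their joint law is a product, and swapping the
  coordinates preserves this. Part (b) needs it with \<open>Y\<close> as reference sample.\<close>

lemma independent_samples_swap:
  assumes "prob_space M" "independent_samples M m X n Y"
  shows "independent_samples M n Y m X"
proof -
  interpret prob_space M by fact
  let ?S = "PiM {..<m} (\<lambda>_. borel :: real measure)" and ?T = "PiM {..<n} (\<lambda>_. borel :: real measure)"
  let ?X = "\<lambda>\<omega>. \<lambda>i\<in>{..<m}. X i \<omega>" and ?Y = "\<lambda>\<omega>. \<lambda>j\<in>{..<n}. Y j \<omega>"
  have ind: "indep_var ?S ?X ?T ?Y"
    using assms(2) by (simp add: independent_samples_def)
  then have [measurable]: "?X \<in> M \<rightarrow>\<^sub>M ?S" "?Y \<in> M \<rightarrow>\<^sub>M ?T"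
    and eq: "distr M ?S ?X \<Otimes>\<^sub>M distr M ?T ?Y = distr M (?S \<Otimes>\<^sub>M ?T) (\<lambda>\<omega>. (?X \<omega>, ?Y \<omega>))"
    unfolding indep_var_distribution_eq by auto
  interpret X: prob_space "distr M ?S ?X" by (rule prob_space_distr) measurable
  interpret Y: prob_space "distr M ?T ?Y" by (rule prob_space_distr) measurable
  interpret YX: pair_prob_space "distr M ?T ?Y" "distr M ?S ?X" ..
  have "distr M ?T ?Y \<Otimes>\<^sub>M distr M ?S ?X
      = distr (distr M ?S ?X \<Otimes>\<^sub>M distr M ?T ?Y) (distr M ?T ?Y \<Otimes>\<^sub>M distr M ?S ?X) (\<lambda>(x, y). (y, x))"
    by (rule YX.distr_pair_swap)
  also have "\<dots> = distr (distr M (?S \<Otimes>\<^sub>M ?T) (\<lambda>\<omega>. (?X \<omega>, ?Y \<omega>))) (?T \<Otimes>\<^sub>M ?S) (\<lambda>(x, y). (y, x))"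
    unfolding eq by (intro distr_cong refl sets_pair_measure_cong) auto
  also have "\<dots> = distr M (?T \<Otimes>\<^sub>M ?S) (\<lambda>\<omega>. (?Y \<omega>, ?X \<omega>))"
    by (subst distr_distr) (auto simp: comp_def)
  finally have "indep_var ?T ?Y ?S ?X"
    unfolding indep_var_distribution_eq by simp
  with assms(2) show ?thesis
    by (simp add: independent_samples_def)
qed

lemma distr_independent_samples:
  assumes "prob_space M" and ind: "independent_samples M m X n Y" and pos: "m > 0" "n > 0"
    and X: "\<And>i. i < m \<Longrightarrow> distr M borel (X i) = \<mu>" and Y: "\<And>j. j < n \<Longrightarrow> distr M borel (Y j) = \<nu>"
  shows "distr M (PiM {..<m} (\<lambda>_. borel) \<Otimes>\<^sub>M PiM {..<n} (\<lambda>_. borel))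
      (\<lambda>\<omega>. (\<lambda>i\<in>{..<m}. X i \<omega>, \<lambda>j\<in>{..<n}. Y j \<omega>))
    = PiM {..<m} (\<lambda>_. \<mu>) \<Otimes>\<^sub>M PiM {..<n} (\<lambda>_. \<nu>)"
proof -
  interpret prob_space M by fact
  have "distr M (PiM {..<m} (\<lambda>_. borel)) (\<lambda>\<omega>. \<lambda>i\<in>{..<m}. X i \<omega>) = PiM {..<m} (\<lambda>i. distr M borel (X i))"
    using ind pos by (subst indep_vars_iff_distr_eq_PiM'[symmetric]) (auto simp: independent_samples_def indep_vars_def)
  also have "\<dots> = PiM {..<m} (\<lambda>_. \<mu>)"
    by (intro PiM_cong) (auto simp: X)
  finally have 1: "distr M (PiM {..<m} (\<lambda>_. borel)) (\<lambda>\<omega>. \<lambda>i\<in>{..<m}. X i \<omega>) = PiM {..<m} (\<lambda>_. \<mu>)" .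
  have "distr M (PiM {..<n} (\<lambda>_. borel)) (\<lambda>\<omega>. \<lambda>j\<in>{..<n}. Y j \<omega>) = PiM {..<n} (\<lambda>j. distr M borel (Y j))"
    using ind pos by (subst indep_vars_iff_distr_eq_PiM'[symmetric]) (auto simp: independent_samples_def indep_vars_def)
  also have "\<dots> = PiM {..<n} (\<lambda>_. \<nu>)"
    by (intro PiM_cong) (auto simp: Y)
  finally have 2: "distr M (PiM {..<n} (\<lambda>_. borel)) (\<lambda>\<omega>. \<lambda>j\<in>{..<n}. Y j \<omega>) = PiM {..<n} (\<lambda>_. \<nu>)" .
  show ?thesis
    using ind unfolding independent_samples_def indep_var_distribution_eq 1 2 by simp
qed

lemma distr_LS_stat:
  assumes "prob_space M" and ind: "independent_samples M m X n Y" and pos: "m > 0" "n > 0"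
    and X: "\<And>i. i < m \<Longrightarrow> distr M borel (X i) = \<mu>" and Y: "\<And>j. j < n \<Longrightarrow> distr M borel (Y j) = \<nu>"
  shows "distr M borel (\<lambda>\<omega>. c * (LS_stat tukey_depth m (\<lambda>i. X i \<omega>) n (\<lambda>j. Y j \<omega>) - a))
      = distr (PiM {..<m} (\<lambda>_. \<mu>) \<Otimes>\<^sub>M PiM {..<n} (\<lambda>_. \<nu>)) borel
          (\<lambda>z. c * (LS_stat tukey_depth m (fst z) n (snd z) - a))"
    and "distr M borel (\<lambda>\<omega>. c * (LS_stat_orig tukey_depth m (\<lambda>i. X i \<omega>) n (\<lambda>j. Y j \<omega>) - a))
      = distr (PiM {..<m} (\<lambda>_. \<mu>) \<Otimes>\<^sub>M PiM {..<n} (\<lambda>_. \<nu>)) borel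
          (\<lambda>z. c * (LS_stat_orig tukey_depth m (fst z) n (snd z) - a))"
proof -
  interpret prob_space M by fact
  let ?B = "PiM {..<m} (\<lambda>_. borel :: real measure) \<Otimes>\<^sub>M PiM {..<n} (\<lambda>_. borel :: real measure)"
  let ?Z = "\<lambda>\<omega>. (\<lambda>i\<in>{..<m}. X i \<omega>, \<lambda>j\<in>{..<n}. Y j \<omega>)"
  have [measurable]: "?Z \<in> M \<rightarrow>\<^sub>M ?B"
    using ind unfolding independent_samples_def indep_var_distribution_eq by (intro measurable_Pair) auto
  have [measurable]: "(\<lambda>z. LS_stat tukey_depth m (fst z) n (snd z)) \<in> borel_measurable ?B"
    "(\<lambda>z. LS_stat_orig tukey_depth m (fst z) n (snd z)) \<in> borel_measurable ?B"
    using measurable_LS_stat[of borel borel m n] measurable_LS_stat_orig[of borel borel m n] by simp_all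
  have cong: "LS_stat tukey_depth m (\<lambda>i. X i \<omega>) n (\<lambda>j. Y j \<omega>) = LS_stat tukey_depth m (fst (?Z \<omega>)) n (snd (?Z \<omega>))"
    "LS_stat_orig tukey_depth m (\<lambda>i. X i \<omega>) n (\<lambda>j. Y j \<omega>) = LS_stat_orig tukey_depth m (fst (?Z \<omega>)) n (snd (?Z \<omega>))"
    for \<omega> by (rule LS_stat_cong; simp)+
  show "distr M borel (\<lambda>\<omega>. c * (LS_stat tukey_depth m (\<lambda>i. X i \<omega>) n (\<lambda>j. Y j \<omega>) - a))
      = distr (PiM {..<m} (\<lambda>_. \<mu>) \<Otimes>\<^sub>M PiM {..<n} (\<lambda>_. \<nu>)) borel
          (\<lambda>z. c * (LS_stat tukey_depth m (fst z) n (snd z) - a))"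
  proof -
    have "distr (distr M ?B ?Z) borel (\<lambda>z. c * (LS_stat tukey_depth m (fst z) n (snd z) - a))
        = distr M borel (\<lambda>\<omega>. c * (LS_stat tukey_depth m (\<lambda>i. X i \<omega>) n (\<lambda>j. Y j \<omega>) - a))"
      unfolding cong by (subst distr_distr) (auto simp: comp_def)
    then show ?thesis
      by (simp only: distr_independent_samples[OF assms])
  qed
  show "distr M borel (\<lambda>\<omega>. c * (LS_stat_orig tukey_depth m (\<lambda>i. X i \<omega>) n (\<lambda>j. Y j \<omega>) - a))
      = distr (PiM {..<m} (\<lambda>_. \<mu>) \<Otimes>\<^sub>M PiM {..<n} (\<lambda>_. \<nu>)) borel
          (\<lambda>z. c * (LS_stat_orig tukey_depth m (fst z) n (snd z) - a))"
  proof -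
    have "distr (distr M ?B ?Z) borel (\<lambda>z. c * (LS_stat_orig tukey_depth m (fst z) n (snd z) - a))
        = distr M borel (\<lambda>\<omega>. c * (LS_stat_orig tukey_depth m (\<lambda>i. X i \<omega>) n (\<lambda>j. Y j \<omega>) - a))"
      unfolding cong by (subst distr_distr) (auto simp: comp_def)
    then show ?thesis
      by (simp only: distr_independent_samples[OF assms])
  qed
qed

text \<open>The identification with the product space requires positive sample sizes, which are
  guaranteed for large \<open>k\<close> only.\<close>

lemma weak_conv_m_cong:
  assumes "weak_conv_m N L" and "eventually (\<lambda>k. N k = N' k) sequentially"
  shows "weak_conv_m N' L"
  unfolding weak_conv_m_def weak_conv_def
proof (intro allI impI)
  fix x assume "isCont (cdf L) x"
  with assms(1) have "(\<lambda>k. cdf (N k) x) \<longlonglongrightarrow> cdf L x"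
    by (simp add: weak_conv_m_def weak_conv_def)
  then show "(\<lambda>k. cdf (N' k) x) \<longlonglongrightarrow> cdf L x"
    by (rule Lim_transform_eventually) (use assms(2) in eventually_elim, simp)
qed

theorem (in two_laws) LS_stat_weak_conv:
  fixes M :: "nat \<Rightarrow> 'a measure" and X Y :: "nat \<Rightarrow> nat \<Rightarrow> 'a \<Rightarrow> real" and p q :: "nat \<Rightarrow> nat"
  assumes M: "\<And>k. prob_space (M k)" and ind: "\<And>k. independent_samples (M k) (p k) (X k) (q k) (Y k)"
    and X: "\<And>k i. i < p k \<Longrightarrow> distr (M k) borel (X k i) = \<mu>"
    and Y: "\<And>k j. j < q k \<Longrightarrow> distr (M k) borel (Y k j) = \<nu>"
    and p: "filterlim p at_top sequentially" and q: "filterlim q at_top sequentially"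
    and \<rho>: "(\<lambda>k. real (p k) / (real (p k) + real (q k))) \<longlonglongrightarrow> \<rho>"
    and \<sigma>_u: "(\<integral>v. (mean_u v - \<theta>)\<^sup>2 \<partial>\<nu>) = \<sigma>_u" and \<sigma>_v: "(\<integral>u. (mean_v u - \<theta>)\<^sup>2 \<partial>\<mu>) = \<sigma>_v"
    and V: "48 * (\<rho> * \<sigma>_u + (1 - \<rho>) * \<sigma>_v) = V" "V > 0" and a: "2 * \<theta> = a"
  shows "weak_conv_m (\<lambda>k. distr (M k) borel (\<lambda>\<omega>.
      sqrt (12 * real (p k) * real (q k) / (real (p k) + real (q k))) *
      (LS_stat tukey_depth (p k) (\<lambda>i. X k i \<omega>) (q k) (\<lambda>j. Y k j \<omega>) - a))) (normal_distribution 0 V)"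
    and "weak_conv_m (\<lambda>k. distr (M k) borel (\<lambda>\<omega>.
      sqrt (12 * real (p k) * real (q k) / (real (p k) + real (q k))) *
      (LS_stat_orig tukey_depth (p k) (\<lambda>i. X k i \<omega>) (q k) (\<lambda>j. Y k j \<omega>) - a))) (normal_distribution 0 V)"
proof -
  have pos: "eventually (\<lambda>k. p k > 0 \<and> q k > 0) sequentially"
    using p[unfolded filterlim_at_top, rule_format, of 1] q[unfolded filterlim_at_top, rule_format, of 1]
    by eventually_elim simp
  have near: "AE z in sample_space (p k) (q k).
      \<bar>LS_stat tukey_depth (p k) (fst z) (q k) (snd z) - 2 * mean_empirical_depth (p k) (fst z) (q k) (snd z)\<bar> \<le> 1 / real (p k)"
    "AE z in sample_space (p k) (q k).
      \<bar>LS_stat_orig tukey_depth (p k) (fst z) (q k) (snd z) - 2 * mean_empirical_depth (p k) (fst z) (q k) (snd z)\<bar> \<le> 1 / real (p k)"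
    if "p k > 0" "q k > 0" for k
    using AE_no_ties[of "p k" "q k"] by (eventually_elim; use that LS_stat_no_ties in auto)+
  show "weak_conv_m (\<lambda>k. distr (M k) borel (\<lambda>\<omega>.
      sqrt (12 * real (p k) * real (q k) / (real (p k) + real (q k))) *
      (LS_stat tukey_depth (p k) (\<lambda>i. X k i \<omega>) (q k) (\<lambda>j. Y k j \<omega>) - a))) (normal_distribution 0 V)"
    unfolding a[symmetric]
  proof (rule weak_conv_m_cong)
    show "weak_conv_m (\<lambda>k. distr (sample_space (p k) (q k)) borel (\<lambda>z.
        sqrt (12 * real (p k) * real (q k) / (real (p k) + real (q k))) *
        (LS_stat tukey_depth (p k) (fst z) (q k) (snd z) - 2 * \<theta>))) (normal_distribution 0 V)"
      by (rule depth_statistic_weak_conv[OF p q \<rho> _ _ \<sigma>_u \<sigma>_v V])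
         (rule measurable_LS_stat near(1), simp_all)+
    show "eventually (\<lambda>k. distr (sample_space (p k) (q k)) borel (\<lambda>z.
        sqrt (12 * real (p k) * real (q k) / (real (p k) + real (q k))) *
        (LS_stat tukey_depth (p k) (fst z) (q k) (snd z) - 2 * \<theta>)) =
      distr (M k) borel (\<lambda>\<omega>. sqrt (12 * real (p k) * real (q k) / (real (p k) + real (q k))) *
        (LS_stat tukey_depth (p k) (\<lambda>i. X k i \<omega>) (q k) (\<lambda>j. Y k j \<omega>) - 2 * \<theta>))) sequentially"
      using pos by eventually_elim (rule distr_LS_stat(1)[OF M ind _ _ X Y, symmetric], auto)
  qed
  show "weak_conv_m (\<lambda>k. distr (M k) borel (\<lambda>\<omega>.
      sqrt (12 * real (p k) * real (q k) / (real (p k) + real (q k))) *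
      (LS_stat_orig tukey_depth (p k) (\<lambda>i. X k i \<omega>) (q k) (\<lambda>j. Y k j \<omega>) - a))) (normal_distribution 0 V)"
    unfolding a[symmetric]
  proof (rule weak_conv_m_cong)
    show "weak_conv_m (\<lambda>k. distr (sample_space (p k) (q k)) borel (\<lambda>z.
        sqrt (12 * real (p k) * real (q k) / (real (p k) + real (q k))) *
        (LS_stat_orig tukey_depth (p k) (fst z) (q k) (snd z) - 2 * \<theta>))) (normal_distribution 0 V)"
      by (rule depth_statistic_weak_conv[OF p q \<rho> _ _ \<sigma>_u \<sigma>_v V])
         (rule measurable_LS_stat_orig near(2), simp_all)+
    show "eventually (\<lambda>k. distr (sample_space (p k) (q k)) borel (\<lambda>z.
        sqrt (12 * real (p k) * real (q k) / (real (p k) + real (q k))) *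
        (LS_stat_orig tukey_depth (p k) (fst z) (q k) (snd z) - 2 * \<theta>)) =
      distr (M k) borel (\<lambda>\<omega>. sqrt (12 * real (p k) * real (q k) / (real (p k) + real (q k))) *
        (LS_stat_orig tukey_depth (p k) (\<lambda>i. X k i \<omega>) (q k) (\<lambda>j. Y k j \<omega>) - 2 * \<theta>))) sequentially"
      using pos by eventually_elim (rule distr_LS_stat(2)[OF M ind _ _ X Y, symmetric], auto)
  qed
qed

text \<open>Since \<open>\<mu>\<close> has no atoms, this is the Tukey depth of \<open>v\<close>
  under \<open>\<mu>\<close> itself, and the centring \<open>2 * \<theta>\<close> is twice the mean
  depth of a test point.\<close>

lemma (in two_laws) mean_u_eq:
  "mean_u v = (if cdf \<mu> v \<le> 1 / 2 then cdf \<mu> v else 1 - cdf \<mu> v)"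
proof (cases "cdf \<mu> v \<le> 1 / 2")
  case True
  then have "mean_u v = (\<integral>u. indicator {..v} u \<partial>\<mu>)"
    unfolding mean_u_def by (intro Bochner_Integration.integral_cong refl) (simp add: depth_kernel_def indicator_def)
  then show ?thesis using True by (simp add: cdf_def)
next
  case False
  then have "mean_u v = (\<integral>u. indicator (space \<mu> - {..v}) u \<partial>\<mu>)"
    unfolding mean_u_def by (intro Bochner_Integration.integral_cong refl) (auto simp: depth_kernel_def indicator_def)
  then show ?thesis using False M.prob_compl[of "{..v}"] by (simp add: cdf_def)
qed

section \<open>Uniform laws and integrals of piecewise quadratics\<close>

lemma
  assumes "d > 0"
  shows real_distribution_uniform: "real_distribution (uniform_measure lborel {0<..<d})"
    and AE_uniform_neq: "AE x in uniform_measure lborel {0<..<d}. x \<noteq> u"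
    and AE_uniform_in: "AE x in uniform_measure lborel {0<..<d}. 0 < x \<and> x < d"
    and cdf_uniform: "0 \<le> x \<Longrightarrow> cdf (uniform_measure lborel {0<..<d}) x = min 1 (x / d)"
proof -
  have pos: "emeasure lborel {0<..<d} \<noteq> 0" "emeasure lborel {0<..<d} \<noteq> \<infinity>"
    using assms by auto
  show "real_distribution (uniform_measure lborel {0<..<d})"
    using prob_space_uniform_measure[OF pos]
    by (simp add: real_distribution_def real_distribution_axioms_def)
  show "AE x in uniform_measure lborel {0<..<d}. x \<noteq> u"
    by (rule AE_uniform_measureI) (use AE_lborel_singleton[of u] in auto)
  show "AE x in uniform_measure lborel {0<..<d}. 0 < x \<and> x < d"
    by (rule AE_uniform_measureI) auto
  show "cdf (uniform_measure lborel {0<..<d}) x = min 1 (x / d)" if "0 \<le> x"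
  proof (cases "x < d")
    case True
    then have "{0<..<d} \<inter> {..x} = {0<..x}" by auto
    then show ?thesis
      using pos that True assms by (simp add: cdf_def)
  next
    case False
    then have "{0<..<d} \<inter> {..x} = {0<..<d}" by auto
    then show ?thesis
      using pos that False assms by (simp add: cdf_def)
  qed
qed

text \<open>The integral of \<open>a * x\<^sup>2 + b * x + c\<close> from \<open>s\<close> to
  \<open>t\<close>, as a difference of values of the primitive.\<close>

definition quad_int :: "real \<Rightarrow> real \<Rightarrow> real \<Rightarrow> real \<Rightarrow> real \<Rightarrow> real" where
  "quad_int a b c s t = (a * t ^ 3 / 3 + b * t\<^sup>2 / 2 + c * t) - (a * s ^ 3 / 3 + b * s\<^sup>2 / 2 + c * s)"

text \<open>Three pieces suffice for all means and variances below; shorter case distinctions use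
  pieces of length 0. Nothing is asked of \<open>f\<close> at the break points, which are
  null.\<close>

lemma integral_uniform_piecewise_quadratic:
  fixes f :: "real \<Rightarrow> real"
  assumes "d > 0" and s: "0 \<le> s" "s \<le> t" "t \<le> d" and [measurable]: "f \<in> borel_measurable borel"
    and 1: "\<And>x. 0 < x \<Longrightarrow> x < s \<Longrightarrow> f x = a1 * x\<^sup>2 + b1 * x + c1"
    and 2: "\<And>x. s < x \<Longrightarrow> x < t \<Longrightarrow> f x = a2 * x\<^sup>2 + b2 * x + c2"
    and 3: "\<And>x. t < x \<Longrightarrow> x < d \<Longrightarrow> f x = a3 * x\<^sup>2 + b3 * x + c3"
  shows "(\<integral>x. f x \<partial>uniform_measure lborel {0<..<d})
    = (quad_int a1 b1 c1 0 s + quad_int a2 b2 c2 s t + quad_int a3 b3 c3 t d) / d"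
proof -
  have quad: "has_bochner_integral lborel (\<lambda>x. (a * x\<^sup>2 + b * x + c) * indicator {l..r} x) (quad_int a b c l r)"
    if "l \<le> r" for a b c l r :: real
    unfolding quad_int_def using that
    by (intro has_bochner_integral_FTC_Icc_real[where F = "\<lambda>x. a * x ^ 3 / 3 + b * x\<^sup>2 / 2 + c * x"])
       (auto intro!: derivative_eq_intros)
  let ?g = "\<lambda>x. (a1 * x\<^sup>2 + b1 * x + c1) * indicator {0..s} x + (a2 * x\<^sup>2 + b2 * x + c2) * indicator {s..t} x
    + (a3 * x\<^sup>2 + b3 * x + c3) * indicator {t..d} x"
  have g: "has_bochner_integral lborel ?g (quad_int a1 b1 c1 0 s + quad_int a2 b2 c2 s t + quad_int a3 b3 c3 t d)"
    by (intro has_bochner_integral_add quad s)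
  have "uniform_measure lborel {0<..<d} = density lborel (\<lambda>x. ennreal (indicator {0<..<d} x / d))"
    unfolding uniform_measure_def using assms(1)
    using divide_ennreal[of 1 d] by (intro density_cong) (auto simp: indicator_def)
  then have "(\<integral>x. f x \<partial>uniform_measure lborel {0<..<d}) = (\<integral>x. indicator {0<..<d} x / d * f x \<partial>lborel)"
    using assms(1) by (simp add: integral_density)
  also have "\<dots> = (\<integral>x. ?g x / d \<partial>lborel)"
  proof (rule integral_cong_AE)
    have "AE x in lborel. x \<noteq> 0 \<and> x \<noteq> s \<and> x \<noteq> t \<and> x \<noteq> d"
      using AE_lborel_singleton[of 0] AE_lborel_singleton[of s] AE_lborel_singleton[of t] AE_lborel_singleton[of d]
      by eventually_elim simp
    then show "AE x in lborel. indicator {0<..<d} x / d * f x = ?g x / d"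
    proof eventually_elim
      case (elim x)
      consider "x < 0" | "0 < x" "x < s" | "s < x" "x < t" | "t < x" "x < d" | "d < x"
        using elim by linarith
      then show ?case
        using s by cases (simp_all add: indicator_def 1 2 3)
    qed
  qed measurable
  also have "\<dots> = (quad_int a1 b1 c1 0 s + quad_int a2 b2 c2 s t + quad_int a3 b3 c3 t d) / d"
    using has_bochner_integral_integral_eq[OF g] by simp
  finally show ?thesis .
qed

subsection \<open>Uniform samples\<close>

abbreviation (input) uniform_law :: "real \<Rightarrow> real measure" where
  "uniform_law d \<equiv> uniform_measure lborel {0<..<d}"

lemma two_laws_uniform:
  assumes "c > 0" "d > 0"
  shows "two_laws (uniform_law c) (uniform_law d)"
proof (rule two_laws.intro)
  \<comment> \<open>On the positive axis the distribution function equals 1/2 only at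
    \<open>c / 2\<close>, and a single point is null.\<close>
  show "AE v in uniform_law d. cdf (uniform_law c) v \<noteq> 1 / 2"
    using AE_uniform_neq[OF \<open>d > 0\<close>, of "c / 2"] AE_uniform_in[OF \<open>d > 0\<close>]
    by eventually_elim (use assms in \<open>auto simp: cdf_uniform min_def field_simps\<close>)
qed (use assms in \<open>auto intro: real_distribution_uniform AE_uniform_neq\<close>)

text \<open>\<open>ref_full\<close> serves part (a): the reference median 1/2 is the right end of
  the test interval, so only the first branch of the kernel occurs there. \<open>ref_half\<close>
  serves part (b): its reference median 1/4 is interior to the test interval, so both branches
  occur.\<close>

interpretation ref_full: two_laws "uniform_law 1" "uniform_law (1/2)"
  by (rule two_laws_uniform) auto

interpretation ref_half: two_laws "uniform_law (1/2)" "uniform_law 1"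
  by (rule two_laws_uniform) auto

lemma ref_full_mean_u: "0 < v \<Longrightarrow> v < 1 / 2 \<Longrightarrow> ref_full.mean_u v = v"
  by (simp add: ref_full.mean_u_eq cdf_uniform)

text \<open>On the whole test interval the kernel is the indicator of \<open>u \<le> v\<close>, so
  this is the upper tail of U(0,1/2) at \<open>u\<close>.\<close>

lemma ref_full_mean_v:
  assumes "0 < u"
  shows "ref_full.mean_v u = (if u < 1 / 2 then 1 - 2 * u else 0)"
proof (cases "u < 1 / 2")
  case True
  have "ref_full.mean_v u = (quad_int 0 0 0 0 u + quad_int 0 0 1 u (1/2) + quad_int 0 0 0 (1/2) (1/2)) / (1/2)"
    unfolding ref_full.mean_v_def using assms True
    by (intro integral_uniform_piecewise_quadratic) (auto simp: ref_full.depth_kernel_def cdf_uniform)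
  with True show ?thesis by (simp add: quad_int_def)
next
  case False
  have "ref_full.mean_v u = (quad_int 0 0 0 0 0 + quad_int 0 0 0 0 0 + quad_int 0 0 0 0 (1/2)) / (1/2)"
    unfolding ref_full.mean_v_def using False
    by (intro integral_uniform_piecewise_quadratic) (auto simp: ref_full.depth_kernel_def cdf_uniform)
  with False show ?thesis by (simp add: quad_int_def)
qed

lemma ref_full_\<theta>: "ref_full.\<theta> = 1 / 4"
proof -
  have "ref_full.\<theta> = (quad_int 0 0 0 0 0 + quad_int 0 0 0 0 0 + quad_int 0 1 0 0 (1/2)) / (1/2)"
    unfolding ref_full.\<theta>_def by (intro integral_uniform_piecewise_quadratic) (auto simp: ref_full_mean_u)
  then show ?thesis by (simp add: quad_int_def power_divide)
qed

text \<open>\<open>mean_u\<close> is the identity on the test interval, so this is the variance of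
  U(0,1/2).\<close>

lemma ref_full_variance_u: "(\<integral>v. (ref_full.mean_u v - ref_full.\<theta>)\<^sup>2 \<partial>uniform_law (1/2)) = 1 / 48"
proof -
  have "(\<integral>v. (ref_full.mean_u v - ref_full.\<theta>)\<^sup>2 \<partial>uniform_law (1/2)) =
      (quad_int 0 0 0 0 0 + quad_int 0 0 0 0 0 + quad_int 1 (-1/2) (1/16) 0 (1/2)) / (1/2)"
    unfolding ref_full_\<theta>
    by (intro integral_uniform_piecewise_quadratic) (auto simp: ref_full_mean_u power2_eq_square algebra_simps)
  then show ?thesis by (simp add: quad_int_def power_divide)
qed

text \<open>Under U(0,1), \<open>mean_v\<close> is 0 with probability 1/2 and otherwise uniform on
  (0,1), which gives 1/6 - 1/16.\<close>

lemma ref_full_variance_v: "(\<integral>u. (ref_full.mean_v u - ref_full.\<theta>)\<^sup>2 \<partial>uniform_law 1) = 5 / 48"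
proof -
  have "(\<integral>u. (ref_full.mean_v u - ref_full.\<theta>)\<^sup>2 \<partial>uniform_law 1) =
      (quad_int 0 0 0 0 0 + quad_int 4 (-3) (9/16) 0 (1/2) + quad_int 0 0 (1/16) (1/2) 1) / 1"
    unfolding ref_full_\<theta>
    by (intro integral_uniform_piecewise_quadratic) (auto simp: ref_full_mean_v power2_eq_square algebra_simps)
  then show ?thesis by (simp add: quad_int_def power_divide)
qed

lemma ref_half_mean_u:
  assumes "0 < v"
  shows "ref_half.mean_u v = (if v \<le> 1 / 4 then 2 * v else if v < 1 / 2 then 1 - 2 * v else 0)"
  using assms by (auto simp: ref_half.mean_u_eq cdf_uniform min_def)

text \<open>The test points that count \<open>u\<close> are those between \<open>u\<close> and the
  reference median 1/4, on whichever side \<open>u\<close> lies.\<close>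

lemma ref_half_mean_v:
  assumes "0 < u" "u < 1 / 2"
  shows "ref_half.mean_v u = \<bar>1 / 4 - u\<bar>"
proof (cases "u < 1 / 4")
  case True
  have "ref_half.mean_v u = (quad_int 0 0 0 0 u + quad_int 0 0 1 u (1/4) + quad_int 0 0 0 (1/4) 1) / 1"
    unfolding ref_half.mean_v_def using assms True
    by (intro integral_uniform_piecewise_quadratic) (auto simp: ref_half.depth_kernel_def cdf_uniform min_def)
  with True show ?thesis by (simp add: quad_int_def)
next
  case False
  have "ref_half.mean_v u = (quad_int 0 0 0 0 (1/4) + quad_int 0 0 1 (1/4) u + quad_int 0 0 0 u 1) / 1"
    unfolding ref_half.mean_v_def using assms False
    by (intro integral_uniform_piecewise_quadratic) (auto simp: ref_half.depth_kernel_def cdf_uniform min_def)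
  with False show ?thesis by (simp add: quad_int_def)
qed

lemma ref_half_\<theta>: "ref_half.\<theta> = 1 / 8"
proof -
  have "ref_half.\<theta> = (quad_int 0 2 0 0 (1/4) + quad_int 0 (-2) 1 (1/4) (1/2) + quad_int 0 0 0 (1/2) 1) / 1"
    unfolding ref_half.\<theta>_def by (intro integral_uniform_piecewise_quadratic) (auto simp: ref_half_mean_u)
  then show ?thesis by (simp add: quad_int_def power_divide)
qed

text \<open>Under U(0,1), \<open>mean_u\<close> is 0 with probability 1/2 and otherwise uniform on
  (0,1/2), which gives 1/24 - 1/64. The three quadratics are the squares of 2 x - 1/8, 7/8 - 2 x and
  1/8.\<close>

lemma ref_half_variance_u: "(\<integral>v. (ref_half.mean_u v - ref_half.\<theta>)\<^sup>2 \<partial>uniform_law 1) = 5 / 192"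
proof -
  have "(\<integral>v. (ref_half.mean_u v - ref_half.\<theta>)\<^sup>2 \<partial>uniform_law 1) = (quad_int 4 (-1/2) (1/64) 0 (1/4)
      + quad_int 4 (-7/2) (49/64) (1/4) (1/2) + quad_int 0 0 (1/64) (1/2) 1) / 1"
    unfolding ref_half_\<theta>
    by (intro integral_uniform_piecewise_quadratic) (auto simp: ref_half_mean_u power2_eq_square algebra_simps)
  then show ?thesis by (simp add: quad_int_def power_divide)
qed

text \<open>Under U(0,1/2), the distance to 1/4 is uniform on (0,1/4), with variance 1/12 * 1/16;
  its kink forces the split at 1/4.\<close>

lemma ref_half_variance_v: "(\<integral>u. (ref_half.mean_v u - ref_half.\<theta>)\<^sup>2 \<partial>uniform_law (1/2)) = 1 / 192"
proof -
  have "(\<integral>u. (ref_half.mean_v u - ref_half.\<theta>)\<^sup>2 \<partial>uniform_law (1/2)) = (quad_int 0 0 0 0 0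
      + quad_int 1 (-1/4) (1/64) 0 (1/4) + quad_int 1 (-3/4) (9/64) (1/4) (1/2)) / (1/2)"
    unfolding ref_half_\<theta>
    by (intro integral_uniform_piecewise_quadratic) (auto simp: ref_half_mean_v power2_eq_square algebra_simps)
  then show ?thesis by (simp add: quad_int_def power_divide)
qed

theorem theorem2p1:
  fixes M :: "nat \<Rightarrow> 'a measure"
    and X Y :: "nat \<Rightarrow> nat \<Rightarrow> 'a \<Rightarrow> real"
    and m n :: "nat \<Rightarrow> nat"
    and \<tau> :: real
  assumes "\<And>k. prob_space (M k)"
    and "\<And>k. independent_samples (M k) (m k) (X k) (n k) (Y k)"
    and "\<And>k i. i < m k \<Longrightarrow> distr (M k) borel (X k i) = uniform_measure lborel {0<..<1}"
    and "\<And>k j. j < n k \<Longrightarrow> distr (M k) borel (Y k j) = uniform_measure lborel {0<..<1/2}"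
    and "filterlim m at_top sequentially"
    and "filterlim n at_top sequentially"
    and "(\<lambda>k. real (m k) / (real (m k) + real (n k))) \<longlonglongrightarrow> \<tau>"
    and "0 < \<tau>" and "\<tau> < 1"
  shows
    "weak_conv_m
       (\<lambda>k. distr (M k) borel (\<lambda>\<omega>.
          sqrt (12 * real (m k) * real (n k) / (real (m k) + real (n k))) *
          (LS_stat tukey_depth (m k) (\<lambda>i. X k i \<omega>) (n k) (\<lambda>j. Y k j \<omega>) - 1/2)))
       (normal_distribution 0 (5 - 4 * \<tau>)) \<and>
     weak_conv_m
       (\<lambda>k. distr (M k) borel (\<lambda>\<omega>.
          sqrt (12 * real (m k) * real (n k) / (real (m k) + real (n k))) *
          (LS_stat tukey_depth (n k) (\<lambda>j. Y k j \<omega>) (m k) (\<lambda>i. X k i \<omega>) - 1/4)))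
       (normal_distribution 0 (5/4 - \<tau>)) \<and>
     weak_conv_m
       (\<lambda>k. distr (M k) borel (\<lambda>\<omega>.
          sqrt (12 * real (m k) * real (n k) / (real (m k) + real (n k))) *
          (LS_stat_orig tukey_depth (m k) (\<lambda>i. X k i \<omega>) (n k) (\<lambda>j. Y k j \<omega>) - 1/2)))
       (normal_distribution 0 (5 - 4 * \<tau>)) \<and>
     weak_conv_m
       (\<lambda>k. distr (M k) borel (\<lambda>\<omega>.
          sqrt (12 * real (m k) * real (n k) / (real (m k) + real (n k))) *
          (LS_stat_orig tukey_depth (n k) (\<lambda>j. Y k j \<omega>) (m k) (\<lambda>i. X k i \<omega>) - 1/4)))
       (normal_distribution 0 (5/4 - \<tau>))"
proof -
  note prob = assms(1) and ind = assms(2) and lawX = assms(3) and lawY = assms(4)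
    and m = assms(5) and n = assms(6) and lim = assms(7)
  have ind': "independent_samples (M k) (n k) (Y k) (m k) (X k)" for k
    by (rule independent_samples_swap[OF prob ind])
  \<comment> \<open>With both sizes 0, division by zero would make the two sides of the following
    identity 1 and 0.\<close>
  have "eventually (\<lambda>k. m k \<ge> 1) sequentially"
    using m by (simp add: filterlim_at_top)
  then have "eventually (\<lambda>k. 1 - real (m k) / (real (m k) + real (n k))
      = real (n k) / (real (n k) + real (m k))) sequentially"
    by eventually_elim (simp add: field_simps)
  with tendsto_diff[OF tendsto_const lim]
  have lim': "(\<lambda>k. real (n k) / (real (n k) + real (m k))) \<longlonglongrightarrow> 1 - \<tau>"
    by (rule Lim_transform_eventually)
  \<comment> \<open>Part (a) has \<rho> = \<tau>. In part (b) the reference sample is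
    \<open>Y\<close>, so \<rho> = 1 - \<tau>. Positivity of both variances comes from \<tau> <
    1.\<close>
  have VA: "48 * (\<tau> * (1 / 48) + (1 - \<tau>) * (5 / 48)) = 5 - 4 * \<tau>" "5 - 4 * \<tau> > 0"
    and VB: "48 * ((1 - \<tau>) * (5 / 192) + (1 - (1 - \<tau>)) * (1 / 192)) = 5 / 4 - \<tau>" "5 / 4 - \<tau> > 0"
    using assms(9) by (simp_all add: field_simps)
  have aA: "2 * ref_full.\<theta> = 1 / 2" and aB: "2 * ref_half.\<theta> = 1 / 4"
    by (simp_all add: ref_full_\<theta> ref_half_\<theta>)
  have swap: "12 * real (m k) * real (n k) / (real (m k) + real (n k))
      = 12 * real (n k) * real (m k) / (real (n k) + real (m k))" for k
    by (simp add: ac_simps)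
  note partA = ref_full.LS_stat_weak_conv[OF prob ind lawX lawY m n lim ref_full_variance_u ref_full_variance_v VA aA]
  note partB = ref_half.LS_stat_weak_conv[OF prob ind' lawY lawX n m lim' ref_half_variance_u ref_half_variance_v VB aB]
  show ?thesis
    using partA partB[folded swap] by blast
qed

end
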